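(* Let $R \subset S^2$ be a reduced spherical convex body with $\Delta(R) < \frac{\pi}{2}$. Let $M_1$ and $M_2$ be supporting hemispheres of $R$ such that $\mathrm{width}_{M_1}(R) = \Delta(R) = \mathrm{width}_{M_2}(R)$ and $\mathrm{width}_{M}(R) > \Delta(R)$ for every hemisphere $M$ satisfying $\prec\! M_1 M M_2$. Consider the lunes $L_1 = M_1 \cap M_1^*$ and $L_2 = M_2 \cap M_2^*$. For $i = 1,2$ let $a_i$ be the center of $M_i/M_i^*$ and let $b_i$ be the center of $M_i^*/M_i$. Then the arcs $a_1a_2$ and $b_1b_2$ are contained in $\mathrm{bd}(R)$. Moreover, $|a_1a_2| = |b_1b_2|$.
   Context: $S^2$ is the unit sphere in $E^3$ and $|ab|$ is the spherical (geodesic) distance. For non-antipodal $a,b$, the arc $ab$ is the shorter part of the great circle through $a,b$ (if $a=b$ it is the single point). A set $C\subset S^2$ is convex if it contains no pair of antipodes and $ab\subset C$ for all $a,b\in C$. A convex body is a closed convex set with non-empty interior. The hemisphere $H(m)$ is the set of points at distance at most $\frac{\pi}{2}$ from $m$ (its center). A hemisphere $K$ supports $C$ if $C\subset K$ and $\mathrm{bd}(C)\cap\mathrm{bd}(K)\neq\emptyset$. If hemispheres $G,H$ are different and not opposite (centers not antipodal), $L=G\cap H$ is a lune. It is bounded by two semicircles, $G/H=\mathrm{bd}(G)\cap H$ and $H/G=\mathrm{bd}(H)\cap G$. The center of a semicircle is its midpoint. The thickness $\Delta(L)$ is the spherical distance between the centers of $G/H$ and $H/G$. For a hemisphere $K$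 supporting $C$, $K^*$ denotes a hemisphere supporting $C$ such that the lune $K\cap K^*$ has minimum thickness among all lunes $K\cap K'$ with $K'$ supporting $C$. Put $\mathrm{width}_K(C)=\Delta(K\cap K^* )$. The thickness $\Delta(C)$ of $C$ is the minimum of $\mathrm{width}_K(C)$ over all hemispheres $K$ supporting $C$. A convex body $R$ is reduced if $\Delta(Z)<\Delta(R)$ for every convex body $Z\subset R$ with $Z\neq R$. The polar set of $C$ is $C^\circ=\bigcap_{p\in C}H(p)$. The supporting hemispheres of $C$ are those whose centers lie on $\mathrm{bd}(C^\circ)$. For different supporting hemispheres $X=H(x),Y=H(y),Z=H(z)$ of $C$, write $\prec\! XYZ$ (they support $C$ in this order) if $x,y,z$ occur in this order on the closed curve $\mathrm{bd}(C^\circ)$, traversed in the positive orientation as viewed from inside $C^\circ$. *)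

theory Defs
  imports "HOL-Analysis.Analysis" "HOL-Complex_Analysis.Complex_Analysis"
begin

abbreviation S2 :: "(real^3) set" where
  "S2 \<equiv> sphere 0 1"

definition sph_dist :: "real^3 \<Rightarrow> real^3 \<Rightarrow> real" where
  "sph_dist a b = arccos (a \<bullet> b)"

text \<open>The arc \<open>ab\<close> is the central projection of the chord from \<open>a\<close> to \<open>b\<close> to the sphere.
  It is only meaningful for non-antipodal points; for antipodes the image contains \<open>0\<close>.\<close>

definition sph_arc :: "real^3 \<Rightarrow> real^3 \<Rightarrow> (real^3) set" where
  "sph_arc a b = (\<lambda>x. x /\<^sub>R norm x) ` closed_segment a b"

definition sph_bd :: "(real^3) set \<Rightarrow> (real^3) set" where
  "sph_bd C = top_of_set S2 frontier_of C"

definition sph_convex :: "(real^3) set \<Rightarrow> bool" where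
  "sph_convex C \<longleftrightarrow> C \<subseteq> S2 \<and> (\<forall>a\<in>C. - a \<notin> C) \<and> (\<forall>a\<in>C. \<forall>b\<in>C. sph_arc a b \<subseteq> C)"

definition sph_convex_body :: "(real^3) set \<Rightarrow> bool" where
  "sph_convex_body C \<longleftrightarrow> sph_convex C \<and> closed C \<and> top_of_set S2 interior_of C \<noteq> {}"

definition hemisphere :: "real^3 \<Rightarrow> (real^3) set" where
  "hemisphere m = {p \<in> S2. sph_dist m p \<le> pi / 2}"

definition supports :: "(real^3) set \<Rightarrow> (real^3) set \<Rightarrow> bool" where
  "supports K C \<longleftrightarrow>
     (\<exists>m\<in>S2. K = hemisphere m) \<and> C \<subseteq> K \<and> sph_bd C \<inter> sph_bd K \<noteq> {}"

text \<open>A lune \<open>G \<inter> H\<close> is represented by the ordered pair of hemispheres \<open>G\<close>, \<open>H\<close>.\<close>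

definition is_lune :: "(real^3) set \<Rightarrow> (real^3) set \<Rightarrow> bool" where
  "is_lune G H \<longleftrightarrow>
     (\<exists>g\<in>S2. \<exists>h\<in>S2. G = hemisphere g \<and> H = hemisphere h \<and> g \<noteq> h \<and> g \<noteq> - h)"

definition semicircle :: "(real^3) set \<Rightarrow> (real^3) set \<Rightarrow> (real^3) set" where
  "semicircle G H = sph_bd G \<inter> H"

text \<open>The endpoints of both semicircles bounding a lune \<open>G \<inter> H\<close> are the two points of
  \<open>sph_bd G \<inter> sph_bd H\<close>; the midpoint is the point of the semicircle at equal distance
  from them.\<close>

definition semicircle_center :: "(real^3) set \<Rightarrow> (real^3) set \<Rightarrow> real^3" where
  "semicircle_center G H =
     (THE c. c \<in> semicircle G H \<and>
        (\<forall>e \<in> sph_bd G \<inter> sph_bd H. \<forall>e' \<in> sph_bd G \<inter> sph_bd H. sph_dist c e = sph_dist c e'))"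

definition lune_thickness :: "(real^3) set \<Rightarrow> (real^3) set \<Rightarrow> real" where
  "lune_thickness G H = sph_dist (semicircle_center G H) (semicircle_center H G)"

text \<open>\<open>is_star C K K'\<close>: \<open>K'\<close> is a possible choice of \<open>K\<^sup>*\<close>, which need not be unique in general.
  The width does not depend on the choice.\<close>

definition is_star :: "(real^3) set \<Rightarrow> (real^3) set \<Rightarrow> (real^3) set \<Rightarrow> bool" where
  "is_star C K K' \<longleftrightarrow> is_arg_min (lune_thickness K) (\<lambda>H. supports H C \<and> is_lune K H) K'"

definition width :: "(real^3) set \<Rightarrow> (real^3) set \<Rightarrow> real" where
  "width C K = (THE w. \<exists>K'. is_star C K K' \<and> w = lune_thickness K K')"

definition thickness :: "(real^3) set \<Rightarrow> real" where
  "thickness C = (LEAST w. \<exists>K. supports K C \<and> w = width C K)"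

definition sph_reduced :: "(real^3) set \<Rightarrow> bool" where
  "sph_reduced R \<longleftrightarrow> sph_convex_body R \<and>
     (\<forall>Z. sph_convex_body Z \<and> Z \<subseteq> R \<and> Z \<noteq> R \<longrightarrow> thickness Z < thickness R)"

definition polar :: "(real^3) set \<Rightarrow> (real^3) set" where
  "polar C = (\<Inter>p\<in>C. hemisphere p)"

text \<open>A closed curve bounding \<open>D\<close> is positively oriented if it turns once counterclockwise around
  an interior point \<open>c\<close> of \<open>D\<close>.  This is measured by the orthogonal projection along \<open>c\<close> to the
  tangent plane at \<open>c\<close>, with an orthonormal frame \<open>u\<close>, \<open>v\<close> which is positively oriented for the
  outer normal \<open>c\<close> of the sphere.\<close>

definition positive_boundary_curve :: "(real \<Rightarrow> real^3) \<Rightarrow> (real^3) set \<Rightarrow> bool" where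
  "positive_boundary_curve \<gamma> D \<longleftrightarrow>
     simple_path \<gamma> \<and> pathfinish \<gamma> = pathstart \<gamma> \<and> path_image \<gamma> = sph_bd D \<and>
     (\<exists>c u v. c \<in> top_of_set S2 interior_of D \<and>
        norm u = 1 \<and> norm v = 1 \<and> u \<bullet> v = 0 \<and> cross3 u v = c \<and>
        winding_number (\<lambda>t. Complex (\<gamma> t \<bullet> u) (\<gamma> t \<bullet> v)) 0 = 1)"

text \<open>The relation \<open>\<prec>XYZ\<close>.  The starting point of the closed curve is arbitrary, so it is taken to
  be \<open>x\<close>.  Distinctness of \<open>x\<close>, \<open>y\<close>, \<open>z\<close> follows from the curve being simple.\<close>

definition support_order ::
    "(real^3) set \<Rightarrow> (real^3) set \<Rightarrow> (real^3) set \<Rightarrow> (real^3) set \<Rightarrow> bool" where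
  "support_order C X Y Z \<longleftrightarrow> supports X C \<and> supports Y C \<and> supports Z C \<and>
     (\<exists>x\<in>S2. \<exists>y\<in>S2. \<exists>z\<in>S2. X = hemisphere x \<and> Y = hemisphere y \<and> Z = hemisphere z \<and>
        (\<exists>\<gamma> s t. positive_boundary_curve \<gamma> (polar C) \<and> 0 < s \<and> s < t \<and> t < 1 \<and>
           \<gamma> 0 = x \<and> \<gamma> s = y \<and> \<gamma> t = z))"

end

theory Submission
  imports Defs
begin

text \<open>
  Everything is read off the polar set. The thickness of a lune with hemisphere centers \<open>x\<close> and
  \<open>y\<close> is \<open>\<pi> - |xy|\<close>, so the lunes of thickness \<open>\<Delta>(R)\<close> around \<open>R\<close> correspond to the diametral chords
  of the polar set of \<open>R\<close>: pairs of its points with minimal inner product (\<open>extremal_pair\<close>).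
  The centers of the two semicircles of such a lune are proportional to \<open>y - (x \<bullet> y) x\<close> and
  \<open>x - (x \<bullet> y) y\<close> (\<open>center_vec\<close>), and the first order condition for minimality, together with the
  bipolar theorem, says that both belong to \<open>R\<close>.

  Reducedness enters once, in \<open>centers_generate_reduced\<close>: a linear functional that is nonnegative
  at the semicircle centers of all thinnest lunes is nonnegative on \<open>R\<close>. Otherwise a thin slice of \<open>R\<close>
  that contains no such center could be cut off, and a thinnest lune of the remaining body would
  tend to a thinnest lune of \<open>R\<close> with a center in that slice.

  Let \<open>(p, p')\<close> and \<open>(q, q')\<close> be the chords of the two given lunes. Different diametral chords cross
  properly (\<open>extremal_pairs_cross\<close>, which needs \<open>\<Delta>(R) < \<pi>/2\<close>). As there is no extremal hemisphere
  between \<open>p\<close> and \<open>q\<close>, the cyclic order of the four points on the boundary of the polar set is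
  \<open>p, q, p', q'\<close>, and no chord has an endpoint between \<open>p\<close> and \<open>q\<close> or, by crossing, between \<open>p'\<close>
  and \<open>q'\<close>. A center \<open>e\<close> of a thinnest lune beyond the great circle through \<open>a\<^sub>1\<close> and \<open>a\<^sub>2\<close> would
  give an endpoint between \<open>p\<close> and \<open>q\<close>; hence \<open>a\<^sub>1 \<times> a\<^sub>2\<close> is nonnegative at all centers, and thus on \<open>R\<close>,
  which places the arc \<open>a\<^sub>1a\<^sub>2\<close> in the boundary of \<open>R\<close>. The arc \<open>b\<^sub>1b\<^sub>2\<close> is treated in the same way.

  For the lengths: a thinnest lune becomes thinner if both its hemispheres are rotated about the
  centers of their semicircles in the same sense, so one of the two rotations must cut off a part of \<open>R\<close>
  (\<open>extremal_pair_not_both_rotate\<close>). Applied to both lunes this leaves two mirror cases: the boundary of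
  \<open>M\<^sub>1\<close> contains \<open>a\<^sub>2\<close> and that of \<open>M\<^sub>2\<^sup>*\<close> contains \<open>b\<^sub>1\<close>, or the boundary of \<open>M\<^sub>2\<close> contains \<open>a\<^sub>1\<close> and that
  of \<open>M\<^sub>1\<^sup>*\<close> contains \<open>b\<^sub>2\<close>. Each case yields \<open>p \<bullet> q = p' \<bullet> q'\<close>, from which \<open>|a\<^sub>1a\<^sub>2| = |b\<^sub>1b\<^sub>2|\<close> follows.
\<close>

section \<open>Polar cones of spherically convex sets\<close>

abbreviation triple :: "real^3 \<Rightarrow> real^3 \<Rightarrow> real^3 \<Rightarrow> real" where
  "triple x y z \<equiv> cross3 x y \<bullet> z"

text \<open>The cone over the polar set. Sums and nonnegative multiples stay in it without normalization.\<close>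

definition dual_cone :: "(real^3) set \<Rightarrow> (real^3) set" where
  "dual_cone C = {x. \<forall>p\<in>C. 0 \<le> x \<bullet> p}"

lemma dual_cone_iff: "x \<in> dual_cone C \<longleftrightarrow> (\<forall>p\<in>C. 0 \<le> x \<bullet> p)"
  by (simp add: dual_cone_def)

lemma dual_coneD: "x \<in> dual_cone C \<Longrightarrow> p \<in> C \<Longrightarrow> 0 \<le> x \<bullet> p"
  by (simp add: dual_cone_def)

lemma dual_cone_comb:
  "x \<in> dual_cone C \<Longrightarrow> y \<in> dual_cone C \<Longrightarrow> 0 \<le> s \<Longrightarrow> 0 \<le> t \<Longrightarrow> s *\<^sub>R x + t *\<^sub>R y \<in> dual_cone C"
  by (simp add: dual_cone_def inner_add_left)

lemma hemisphere_eq: "m \<in> S2 \<Longrightarrow> hemisphere m = {p \<in> S2. 0 \<le> m \<bullet> p}"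
proof -
  assume m: "m \<in> S2"
  have "(arccos (m \<bullet> p) \<le> pi / 2) = (0 \<le> m \<bullet> p)" if "p \<in> S2" for p
  proof -
    have "\<bar>m \<bullet> p\<bar> \<le> 1" using m that Cauchy_Schwarz_ineq2[of m p] by simp
    then show ?thesis
      using arccos_le_mono[of "m \<bullet> p" 0] by simp
  qed
  then show ?thesis by (auto simp: hemisphere_def sph_dist_def)
qed

lemma polar_iff:
  assumes "C \<subseteq> S2" "C \<noteq> {}"
  shows "x \<in> polar C \<longleftrightarrow> x \<in> S2 \<and> x \<in> dual_cone C"
  using assms hemisphere_eq by (auto simp: polar_def dual_cone_def inner_commute subset_iff)

lemma polar_subset: "C \<noteq> {} \<Longrightarrow> polar C \<subseteq> S2"
  by (auto simp: polar_def hemisphere_def)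

lemma sgn_S2: "x \<noteq> 0 \<Longrightarrow> sgn x \<in> S2"
  by (simp add: norm_sgn)

lemma sgn_inner: "sgn x \<bullet> y = (x \<bullet> y) / norm x"
  by (simp add: sgn_div_norm divide_inverse mult.commute)

lemma sgn_of_S2: "x \<in> S2 \<Longrightarrow> sgn x = x"
  by (simp add: sgn_div_norm)

lemma norm_scaleR_sgn: "norm x *\<^sub>R sgn x = x"
  by (cases "x = 0") (simp_all add: sgn_div_norm)

lemma sgn_dual_cone: "x \<in> dual_cone C \<Longrightarrow> sgn x \<in> dual_cone C"
  by (simp add: dual_cone_def sgn_inner)

lemma sgn_polar:
  assumes "C \<subseteq> S2" "C \<noteq> {}" "x \<in> dual_cone C" "x \<noteq> 0"
  shows "sgn x \<in> polar C"
  using assms by (simp add: polar_iff sgn_dual_cone sgn_S2[simplified])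

lemma S2_eq_if_same_ray:
  assumes "p \<in> S2" "q \<in> S2" "p = t *\<^sub>R q" "0 \<le> t"
  shows "p = q"
proof -
  have "norm p = t * norm q" using assms by simp
  then show ?thesis using assms by simp
qed

lemma sph_convex_combination:
  assumes C: "sph_convex C" and pq: "p \<in> C" "q \<in> C" and st: "0 \<le> s" "0 \<le> t" "0 < s + t"
  shows "s *\<^sub>R p + t *\<^sub>R q \<noteq> 0" "sgn (s *\<^sub>R p + t *\<^sub>R q) \<in> C"
proof -
  let ?z = "(s / (s + t)) *\<^sub>R p + (t / (s + t)) *\<^sub>R q"
  have eq: "s *\<^sub>R p + t *\<^sub>R q = (s + t) *\<^sub>R ?z"
    using st by (simp add: scaleR_add_right)
  have "?z \<in> closed_segment p q"
    unfolding closed_segment_def using st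
    by (intro CollectI exI[of _ "t / (s + t)"]) (simp add: field_simps)
  moreover have "(\<lambda>x. x /\<^sub>R norm x) = (sgn :: real^3 \<Rightarrow> real^3)"
    by (auto simp: sgn_div_norm)
  ultimately have "sgn ?z \<in> C"
    using C pq unfolding sph_convex_def sph_arc_def by (metis (no_types, lifting) imageI subsetD)
  then show 1: "sgn (s *\<^sub>R p + t *\<^sub>R q) \<in> C"
    using st by (simp only: eq sgn_scaleR) simp
  have S: "C \<subseteq> S2" using C by (simp add: sph_convex_def)
  then have "0 \<notin> C" by auto
  then show "s *\<^sub>R p + t *\<^sub>R q \<noteq> 0" using 1 by (metis sgn_zero)
qed

text \<open>Antipodes are excluded, so no convex combination vanishes; this puts a spherically convex set in an
  open half-space and makes linear separation available.\<close>

lemma sph_convex_hull: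
  assumes C: "sph_convex C" and x: "x \<in> convex hull C"
  shows "x \<noteq> 0" "sgn x \<in> C"
proof -
  let ?K = "{x. x \<noteq> 0 \<and> sgn x \<in> C}"
  have "C \<subseteq> S2" using C by (simp add: sph_convex_def)
  then have "C \<subseteq> ?K" using sgn_of_S2 by fastforce
  moreover have "convex ?K"
  proof (rule convexI)
    fix x y :: "real^3" and u v :: real
    assume *: "x \<in> ?K" "y \<in> ?K" "0 \<le> u" "0 \<le> v" "u + v = 1"
    have "u *\<^sub>R x + v *\<^sub>R y = (u * norm x) *\<^sub>R sgn x + (v * norm y) *\<^sub>R sgn y"
      by (simp flip: scaleR_scaleR add: norm_scaleR_sgn)
    moreover have "0 < u * norm x + v * norm y"
    proof (cases "u = 0")
      case False
      then show ?thesis using * by (intro add_pos_nonneg) auto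
    qed (use * in auto)
    ultimately show "u *\<^sub>R x + v *\<^sub>R y \<in> ?K"
      using sph_convex_combination[OF C, of "sgn x" "sgn y" "u * norm x" "v * norm y"] * by auto
  qed
  ultimately have "convex hull C \<subseteq> ?K" by (rule hull_minimal)
  then show "x \<noteq> 0" "sgn x \<in> C" using x by auto
qed

text \<open>The ray through \<open>p\<close> is closed and misses the compact convex hull of \<open>C\<close>. A functional separating
  the two is bounded above on the ray, hence nonpositive at \<open>p\<close>, and exceeds a positive constant on
  \<open>C\<close>; this margin leaves room for tilting it towards \<open>- p\<close>.\<close>

lemma strictly_separating_functional:
  assumes C: "sph_convex C" "closed C" and p: "p \<in> S2" "p \<notin> C"
  shows "\<exists>x. x \<bullet> p < 0 \<and> (\<forall>q\<in>C. 0 < x \<bullet> q)"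
proof (cases "C = {}")
  case True
  then show ?thesis using p by (intro exI[of _ "- p"]) auto
next
  case False
  have sub: "C \<subseteq> S2" using C by (simp add: sph_convex_def)
  have "compact C" using C(2) sub by (meson bounded_sphere bounded_subset compact_eq_bounded_closed)
  then have cH: "compact (convex hull C)" by (rule compact_convex_hull)
  let ?S = "(\<lambda>t. t *\<^sub>R p) ` {0..}"
  have "linear (\<lambda>t. t *\<^sub>R p)" by (simp add: bounded_linear.linear bounded_linear_scaleR_left)
  moreover have "inj (\<lambda>t. t *\<^sub>R p)" using p by (auto intro!: injI)
  ultimately have S: "convex ?S" "closed ?S"
    by (auto intro!: convex_linear_image closed_injective_linear_image)
  have "?S \<inter> (convex hull C) = {}"
  proof (rule ccontr)
    assume "?S \<inter> (convex hull C) \<noteq> {}"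
    then obtain t where t: "0 \<le> t" "t *\<^sub>R p \<in> convex hull C" by auto
    from sph_convex_hull[OF C(1) t(2)] have "t \<noteq> 0" "sgn (t *\<^sub>R p) \<in> C" by auto
    then show False using t p by (simp add: sgn_scaleR sgn_of_S2[simplified])
  qed
  then obtain a b where ab: "\<forall>x\<in>?S. a \<bullet> x < b" "\<forall>x\<in>convex hull C. b < a \<bullet> x"
    using separating_hyperplane_closed_compact[OF S convex_convex_hull cH] False by auto
  have ab1: "t * (a \<bullet> p) < b" if "0 \<le> t" for t using bspec[OF ab(1), of "t *\<^sub>R p"] that by auto
  have b: "0 < b" using ab1[of 0] by simp
  have ap: "a \<bullet> p \<le> 0"
  proof (rule ccontr)
    assume "\<not> a \<bullet> p \<le> 0"
    then show False using ab1[of "b / (a \<bullet> p)"] b by simp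
  qed
  have "0 < (a - (b/2) *\<^sub>R p) \<bullet> q" if "q \<in> C" for q
  proof -
    have 1: "b < a \<bullet> q" using bspec[OF ab(2) hull_inc[OF that]] .
    have "p \<bullet> q \<le> 1" using p(1) sub that Cauchy_Schwarz_ineq2[of p q] by auto
    then have "(b/2) * (p \<bullet> q) \<le> (b/2) * 1" using b by (intro mult_left_mono) auto
    moreover have "(a - (b/2) *\<^sub>R p) \<bullet> q = a \<bullet> q - (b/2) * (p \<bullet> q)" by (simp add: inner_diff_left)
    ultimately show ?thesis using b 1 by linarith
  qed
  moreover have "(a - (b/2) *\<^sub>R p) \<bullet> p < 0"
    using ap b p by (simp add: inner_diff_left dot_square_norm)
  ultimately show ?thesis by blast
qed

lemma body_facts:
  assumes "sph_convex_body C"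
  shows "sph_convex C" "closed C" "C \<subseteq> S2" "C \<noteq> {}" "compact C"
proof -
  show 1: "sph_convex C" "closed C" and 2: "C \<noteq> {}"
    using assms interior_of_subset by (auto simp: sph_convex_body_def)
  show 3: "C \<subseteq> S2" using 1 by (simp add: sph_convex_def)
  show "compact C" using 1 3 by (meson bounded_sphere bounded_subset compact_eq_bounded_closed)
qed

lemma body_polar_iff:
  assumes "sph_convex_body C"
  shows "x \<in> polar C \<longleftrightarrow> x \<in> S2 \<and> x \<in> dual_cone C"
  using polar_iff body_facts(3,4)[OF assms] by blast

lemma body_sgn_polar:
  assumes "sph_convex_body C" "x \<in> dual_cone C" "x \<noteq> 0"
  shows "sgn x \<in> polar C"
  using sgn_polar body_facts(3,4)[OF assms(1)] assms by blast

lemma bipolar: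
  assumes C: "sph_convex_body C" and v: "\<And>x. x \<in> polar C \<Longrightarrow> 0 \<le> x \<bullet> v" "v \<noteq> 0"
  shows "sgn v \<in> C"
proof (rule ccontr)
  assume "sgn v \<notin> C"
  then obtain x where x: "x \<bullet> sgn v < 0" "\<forall>q\<in>C. 0 < x \<bullet> q"
    using strictly_separating_functional[OF body_facts(1,2)[OF C] sgn_S2[OF v(2)]] by blast
  then have "x \<noteq> 0" "x \<in> dual_cone C" by (auto simp: dual_cone_def intro: less_imp_le)
  then have "0 \<le> sgn x \<bullet> v" using v(1) body_sgn_polar[OF C] by blast
  then have "0 \<le> x \<bullet> v" using \<open>x \<noteq> 0\<close> by (simp add: sgn_inner zero_le_divide_iff)
  moreover have "x \<bullet> v < 0"
    using x(1) v(2) by (simp add: sgn_inner inner_commute[of x] divide_less_0_iff)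
  ultimately show False by simp
qed

lemma strictly_positive_functional:
  assumes C: "sph_convex_body C"
  obtains x where "\<And>q. q \<in> C \<Longrightarrow> 0 < x \<bullet> q"
proof -
  obtain p where "p \<in> C" using body_facts(4)[OF C] by blast
  then have "- p \<notin> C" "- p \<in> S2" using body_facts(1,3)[OF C] by (auto simp: sph_convex_def)
  then show ?thesis
    using strictly_separating_functional[OF body_facts(1,2)[OF C]] that by meson
qed

lemma interior_S2_iff:
  assumes "C \<subseteq> S2"
  shows "p \<in> top_of_set S2 interior_of C \<longleftrightarrow> p \<in> S2 \<and> (\<exists>r>0. \<forall>q\<in>S2. dist q p < r \<longrightarrow> q \<in> C)"
proof
  assume "p \<in> top_of_set S2 interior_of C"
  then obtain T where T: "openin (top_of_set S2) T" "p \<in> T" "T \<subseteq> C" by (auto simp: interior_of_def)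
  then obtain r where "r > 0" "ball p r \<inter> S2 \<subseteq> T" "p \<in> S2"
    unfolding openin_contains_ball by blast
  then show "p \<in> S2 \<and> (\<exists>r>0. \<forall>q\<in>S2. dist q p < r \<longrightarrow> q \<in> C)"
    using T(3) by (fastforce simp: dist_commute)
next
  assume "p \<in> S2 \<and> (\<exists>r>0. \<forall>q\<in>S2. dist q p < r \<longrightarrow> q \<in> C)"
  then obtain r where r: "p \<in> S2" "0 < r" "\<forall>q\<in>S2. dist q p < r \<longrightarrow> q \<in> C" by blast
  have "openin (top_of_set S2) (S2 \<inter> ball p r)" by (simp add: openin_open_Int)
  moreover have "p \<in> S2 \<inter> ball p r" "S2 \<inter> ball p r \<subseteq> C" using r by (auto simp: dist_commute)
  ultimately show "p \<in> top_of_set S2 interior_of C" unfolding interior_of_def by blast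
qed

lemma sgn_perturbation_tendsto:
  fixes p x :: "real^3"
  assumes "p \<in> S2"
  shows "((\<lambda>e. sgn (p + e *\<^sub>R x)) \<longlongrightarrow> p) (at_right 0)"
proof -
  have "((\<lambda>e. sgn (p + e *\<^sub>R x)) \<longlongrightarrow> sgn (p + 0 *\<^sub>R x)) (at_right 0)"
    using assms by (intro tendsto_intros) auto
  then show ?thesis using assms by (simp add: sgn_of_S2[simplified])
qed

lemma perturb_in_interior:
  assumes C: "C \<subseteq> S2" and p: "p \<in> top_of_set S2 interior_of C"
  obtains e where "e > 0" "p + e *\<^sub>R x \<noteq> 0" "sgn (p + e *\<^sub>R x) \<in> C"
proof -
  obtain r where r: "p \<in> S2" "r > 0" "\<And>q. q \<in> S2 \<Longrightarrow> dist q p < r \<Longrightarrow> q \<in> C"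
    using p interior_S2_iff[OF C] by blast
  have "\<forall>\<^sub>F e in at_right 0. dist (sgn (p + e *\<^sub>R x)) p < r"
    using tendstoD[OF sgn_perturbation_tendsto[OF r(1)] r(2)] .
  moreover have "((\<lambda>e. p + e *\<^sub>R x) \<longlongrightarrow> p + 0 *\<^sub>R x) (at_right 0)" by (intro tendsto_intros)
  then have "\<forall>\<^sub>F e in at_right 0. p + e *\<^sub>R x \<noteq> 0"
    using r(1) by (intro tendsto_imp_eventually_ne[of _ p]) auto
  moreover have "\<forall>\<^sub>F e in at_right (0::real). e > 0" by (simp add: eventually_at_right_less)
  ultimately have "\<forall>\<^sub>F e in at_right 0. e > 0 \<and> p + e *\<^sub>R x \<noteq> 0 \<and> dist (sgn (p + e *\<^sub>R x)) p < r"
    by eventually_elim auto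
  then obtain e where "e > 0" "p + e *\<^sub>R x \<noteq> 0" "dist (sgn (p + e *\<^sub>R x)) p < r"
    using eventually_happens trivial_limit_at_right_real by blast
  then show ?thesis using that r(3) sgn_S2 by blast
qed

text \<open>A small move of an interior point against \<open>x\<close> stays inside \<open>C\<close>, where \<open>x\<close> is nonnegative.\<close>

lemma interior_pos:
  assumes C: "C \<subseteq> S2" and p: "p \<in> top_of_set S2 interior_of C" and x: "x \<in> dual_cone C" "x \<noteq> 0"
  shows "0 < x \<bullet> p"
proof -
  obtain e where e: "e > 0" "p + e *\<^sub>R (- x) \<noteq> 0" "sgn (p + e *\<^sub>R (- x)) \<in> C"
    using perturb_in_interior[OF C p] by blast
  then have "0 \<le> x \<bullet> sgn (p + e *\<^sub>R (- x))" using dual_coneD[OF x(1)] by blast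
  then have "0 \<le> x \<bullet> (p + e *\<^sub>R (- x))"
    using e(2) by (simp add: inner_commute[of x] sgn_inner zero_le_divide_iff)
  then have "e * (x \<bullet> x) \<le> x \<bullet> p" by (simp add: inner_diff_right)
  moreover have "0 < e * (x \<bullet> x)" using e(1) x(2) by simp
  ultimately show ?thesis by linarith
qed

lemma body_interior_point:
  assumes C: "sph_convex_body C"
  obtains p where "p \<in> C" "p \<in> top_of_set S2 interior_of C" "\<And>x. x \<in> dual_cone C \<Longrightarrow> x \<noteq> 0 \<Longrightarrow> 0 < x \<bullet> p"
proof -
  obtain p where p: "p \<in> top_of_set S2 interior_of C" using C by (auto simp: sph_convex_body_def)
  show ?thesis
  proof (rule that[OF _ p])
    show "p \<in> C" using p interior_of_subset[of "top_of_set S2" C] by blast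
    show "0 < x \<bullet> p" if "x \<in> dual_cone C" "x \<noteq> 0" for x
      using interior_pos[OF body_facts(3)[OF C] p that] .
  qed
qed

lemma dual_cone_pointed:
  assumes C: "sph_convex_body C" and x: "x \<in> dual_cone C" "- x \<in> dual_cone C"
  shows "x = 0"
proof (rule ccontr)
  assume "x \<noteq> 0"
  obtain p where "\<And>x. x \<in> dual_cone C \<Longrightarrow> x \<noteq> 0 \<Longrightarrow> 0 < x \<bullet> p" using body_interior_point[OF C] by metis
  from this[of x] this[of "-x"] show False using x \<open>x \<noteq> 0\<close> by auto
qed

lemma sph_bd_eq: "closed C \<Longrightarrow> C \<subseteq> S2 \<Longrightarrow> sph_bd C = C - top_of_set S2 interior_of C"
  unfolding sph_bd_def frontier_of_def
  by (metis closedin_closed_subtopology closure_of_eq closed_closedin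
      closed_subset)

lemma sph_bdI:
  assumes "closed C" "C \<subseteq> S2" "p \<in> C" "x \<in> dual_cone C" "x \<noteq> 0" "x \<bullet> p = 0"
  shows "p \<in> sph_bd C"
  using assms interior_pos[of C p x] by (auto simp: sph_bd_eq)

section \<open>Supporting hemispheres and lunes\<close>

lemma compact_polar:
  assumes "C \<subseteq> S2" "C \<noteq> {}" shows "compact (polar C)"
proof -
  have "closed (hemisphere p)" if "p \<in> C" for p
  proof -
    have "hemisphere p = S2 \<inter> {q. 0 \<le> p \<bullet> q}" using hemisphere_eq assms(1) that by blast
    then show ?thesis by (simp only: closed_Int closed_sphere closed_halfspace_ge)
  qed
  then have "closed (polar C)" unfolding polar_def by (rule closed_INT[OF ballI])
  then show ?thesis
    using polar_subset[OF assms(2)] by (meson bounded_sphere bounded_subset compact_eq_bounded_closed)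
qed

text \<open>By compactness of \<open>C\<close> the values \<open>c \<bullet> p\<close> have a positive lower bound, which absorbs small changes
  of \<open>c\<close>.\<close>

lemma interior_polar:
  assumes C: "compact C" "C \<subseteq> S2" "C \<noteq> {}"
  shows "c \<in> top_of_set S2 interior_of polar C \<longleftrightarrow> c \<in> S2 \<and> (\<forall>p\<in>C. 0 < c \<bullet> p)"
proof
  assume L: "c \<in> top_of_set S2 interior_of polar C"
  then have c: "c \<in> S2" using interior_S2_iff[OF polar_subset[OF C(3)]] by blast
  have "0 < c \<bullet> p" if p: "p \<in> C" for p
  proof -
    obtain e where e: "e > 0" "c + e *\<^sub>R (- p) \<noteq> 0" "sgn (c + e *\<^sub>R (- p)) \<in> polar C"
      using perturb_in_interior[OF polar_subset[OF C(3)] L] by blast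
    then have "0 \<le> sgn (c + e *\<^sub>R (- p)) \<bullet> p"
      using p polar_iff[OF C(2,3)] dual_coneD by blast
    then have "0 \<le> (c + e *\<^sub>R (- p)) \<bullet> p"
      using e(2) by (simp add: sgn_inner zero_le_divide_iff)
    moreover have "p \<bullet> p = 1" using p C(2) by (auto simp: dot_square_norm)
    ultimately show ?thesis using e(1) by (simp add: inner_diff_left)
  qed
  then show "c \<in> S2 \<and> (\<forall>p\<in>C. 0 < c \<bullet> p)" using c by blast
next
  assume R: "c \<in> S2 \<and> (\<forall>p\<in>C. 0 < c \<bullet> p)"
  obtain p0 where p0: "p0 \<in> C" "\<And>p. p \<in> C \<Longrightarrow> c \<bullet> p0 \<le> c \<bullet> p"
    using continuous_attains_inf[OF C(1,3), of "\<lambda>p. c \<bullet> p"] continuous_on_inner[OF continuous_on_const continuous_on_id]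
    by metis
  have "q \<in> polar C" if q: "q \<in> S2" "dist q c < c \<bullet> p0" for q
  proof -
    have "0 \<le> q \<bullet> p" if p: "p \<in> C" for p
    proof -
      have "\<bar>(q - c) \<bullet> p\<bar> \<le> norm (q - c) * norm p" by (rule Cauchy_Schwarz_ineq2)
      also have "\<dots> = dist q c" using p C(2) by (auto simp: dist_norm)
      finally have "\<bar>(q - c) \<bullet> p\<bar> < c \<bullet> p" using q(2) p0(2)[OF p] by linarith
      then show ?thesis by (simp add: inner_diff_left)
    qed
    then show ?thesis using q polar_iff[OF C(2,3)] by (simp add: dual_cone_def)
  qed
  then show "c \<in> top_of_set S2 interior_of polar C"
    using interior_S2_iff[OF polar_subset[OF C(3)]] R p0(1) by blast
qed

lemma sph_bd_polar:
  assumes C: "compact C" "C \<subseteq> S2" "C \<noteq> {}"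
  shows "sph_bd (polar C) = {x \<in> polar C. \<exists>p\<in>C. x \<bullet> p = 0}"
proof -
  have "sph_bd (polar C) = polar C - top_of_set S2 interior_of polar C"
    using sph_bd_eq compact_imp_closed[OF compact_polar[OF C(2,3)]] polar_subset[OF C(3)] by blast
  also have "\<dots> = {x \<in> polar C. \<exists>p\<in>C. x \<bullet> p = 0}"
    using interior_polar[OF C] polar_iff[OF C(2,3)] dual_coneD by (auto simp: order_less_le)
  finally show ?thesis .
qed

lemma sph_bd_hemisphere:
  assumes "m \<in> S2" shows "sph_bd (hemisphere m) = {q \<in> S2. m \<bullet> q = 0}"
proof -
  have "hemisphere m = polar {m}" by (simp add: polar_def)
  then show ?thesis using sph_bd_polar[of "{m}"] assms hemisphere_eq[OF assms]
    by (auto simp: inner_commute)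
qed

lemma S2_inner_self: "x \<in> S2 \<Longrightarrow> x \<bullet> x = 1" by (simp add: dot_square_norm)

lemma S2_inner_less_one: "x \<in> S2 \<Longrightarrow> y \<in> S2 \<Longrightarrow> x \<noteq> y \<Longrightarrow> x \<bullet> y < 1"
proof -
  assume a: "x \<in> S2" "y \<in> S2" "x \<noteq> y"
  have "(x - y) \<bullet> (x - y) = 2 - 2 * (x \<bullet> y)"
    using a(1,2) by (simp add: inner_diff_left inner_diff_right inner_commute S2_inner_self[simplified])
  moreover have "0 < (x - y) \<bullet> (x - y)" using a(3) by simp
  ultimately show ?thesis by linarith
qed

lemma S2_inner_greater: "x \<in> S2 \<Longrightarrow> y \<in> S2 \<Longrightarrow> x \<noteq> - y \<Longrightarrow> - 1 < x \<bullet> y"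
  using S2_inner_less_one[of x "- y"] by simp

lemma hemisphere_inj:
  assumes "g \<in> S2" "h \<in> S2" "hemisphere g = hemisphere h" shows "g = h"
proof (rule ccontr)
  assume ne: "g \<noteq> h"
  have "g \<bullet> h < 1" using S2_inner_less_one assms ne by blast
  then have "0 \<le> g \<bullet> (g - h)" "h \<bullet> (g - h) < 0"
    using assms(1,2) by (simp_all add: inner_diff_right S2_inner_self[simplified] inner_commute)
  moreover have "0 < norm (g - h)" using ne by simp
  ultimately have "0 \<le> g \<bullet> sgn (g - h)" "h \<bullet> sgn (g - h) < 0"
    by (simp_all add: inner_commute[of _ "sgn (g - h)"] sgn_inner zero_le_divide_iff
        divide_less_0_iff inner_commute[of _ "g - h"])
  then have "sgn (g - h) \<in> hemisphere g" "sgn (g - h) \<notin> hemisphere h"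
    using assms(1,2) sgn_S2[of "g - h"] ne by (auto simp: hemisphere_eq)
  then show False using assms(3) by simp
qed

lemma supports_iff:
  assumes C: "sph_convex_body C" and m: "m \<in> S2"
  shows "supports (hemisphere m) C \<longleftrightarrow> m \<in> sph_bd (polar C)"
proof -
  note F = body_facts[OF C]
  have bd: "m \<in> sph_bd (polar C) \<longleftrightarrow> C \<subseteq> hemisphere m \<and> (\<exists>p\<in>C. m \<bullet> p = 0)"
    using F(3) m by (auto simp: sph_bd_polar[OF F(5,3,4)] body_polar_iff[OF C] dual_cone_def hemisphere_eq)
  have "sph_bd C \<subseteq> C" using sph_bd_eq[OF F(2,3)] by blast
  moreover have "p \<in> sph_bd C" if "C \<subseteq> hemisphere m" "p \<in> C" "m \<bullet> p = 0" for p
    using that m by (intro sph_bdI[OF F(2,3) that(2), of m]) (auto simp: dual_cone_def hemisphere_eq)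
  ultimately show ?thesis
    unfolding supports_def bd sph_bd_hemisphere[OF m] using m F(3) by blast
qed

text \<open>A vector pointing to the center of the semicircle \<open>H(x)/H(y)\<close>, namely the part of \<open>y\<close> orthogonal to
  \<open>x\<close>. It is not normalized so that it stays polynomial in \<open>x\<close> and \<open>y\<close>.\<close>

definition center_vec :: "real^3 \<Rightarrow> real^3 \<Rightarrow> real^3" where
  "center_vec x y = y - (x \<bullet> y) *\<^sub>R x"

lemma center_vec_orth: "x \<in> S2 \<Longrightarrow> center_vec x y \<bullet> x = 0"
  by (simp add: center_vec_def inner_diff_left inner_diff_right S2_inner_self[simplified] inner_commute)

lemma center_vec_inner_other: "x \<in> S2 \<Longrightarrow> y \<in> S2 \<Longrightarrow> center_vec x y \<bullet> y = 1 - (x \<bullet> y)\<^sup>2"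
  by (simp add: center_vec_def inner_diff_left S2_inner_self[simplified] power2_eq_square)

lemma center_vec_norm: "x \<in> S2 \<Longrightarrow> y \<in> S2 \<Longrightarrow> (norm (center_vec x y))\<^sup>2 = 1 - (x \<bullet> y)\<^sup>2"
  unfolding dot_square_norm[symmetric]
  by (simp add: center_vec_def inner_diff_left inner_diff_right S2_inner_self[simplified] power2_eq_square inner_commute)

lemma center_vec_inner_center_vec: "x \<in> S2 \<Longrightarrow> y \<in> S2 \<Longrightarrow> center_vec x y \<bullet> center_vec y x = - (x \<bullet> y) * (1 - (x \<bullet> y)\<^sup>2)"
  by (simp add: center_vec_def inner_diff_left inner_diff_right S2_inner_self[simplified] power2_eq_square inner_commute)
   (simp add: algebra_simps)

lemma S2_inner_sq_less: "x \<in> S2 \<Longrightarrow> y \<in> S2 \<Longrightarrow> x \<noteq> y \<Longrightarrow> x \<noteq> - y \<Longrightarrow> 0 < 1 - (x \<bullet> y)\<^sup>2"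
  using S2_inner_less_one[of x y] S2_inner_greater[of x y] by (simp add: abs_square_less_1)

lemma center_vec_nonzero: "x \<in> S2 \<Longrightarrow> y \<in> S2 \<Longrightarrow> x \<noteq> y \<Longrightarrow> x \<noteq> - y \<Longrightarrow> center_vec x y \<noteq> 0"
  using center_vec_norm[of x y] S2_inner_sq_less[of x y] by auto

lemmas cross3_coordinates = cross3_def inner_vec_def sum_3 vec_eq_iff forall_3

text \<open>Expansion of \<open>w\<close> in the basis \<open>g\<close>, \<open>h\<close>, \<open>g \<times> h\<close>, multiplied by the Gram determinant of \<open>g\<close> and \<open>h\<close>.\<close>

lemma frame_expansion:
  fixes g h w :: "real^3"
  shows "(cross3 g h \<bullet> cross3 g h) *\<^sub>R w =
    ((w \<bullet> g) * (h \<bullet> h) - (w \<bullet> h) * (g \<bullet> h)) *\<^sub>R g + ((w \<bullet> h) * (g \<bullet> g) - (w \<bullet> g) * (g \<bullet> h)) *\<^sub>R h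
    + (triple g h w) *\<^sub>R cross3 g h"
  by (simp add: cross3_coordinates algebra_simps)

lemma cross_norm: "cross3 g h \<bullet> cross3 g h = (g \<bullet> g) * (h \<bullet> h) - (g \<bullet> h)\<^sup>2"
  by (simp add: cross3_coordinates power2_eq_square algebra_simps)

text \<open>The endpoints of the semicircle are the two unit multiples of \<open>g \<times> h\<close>. A point at equal distance
  from both is orthogonal to \<open>g \<times> h\<close>, and together with orthogonality to \<open>g\<close> only one direction and
  its opposite remain.\<close>

lemma semicircle_center_eq:
  assumes g: "g \<in> S2" and h: "h \<in> S2" and ne: "g \<noteq> h" "g \<noteq> - h"
  shows "semicircle_center (hemisphere g) (hemisphere h) = sgn (center_vec g h)"
proof -
  have pos: "0 < 1 - (g \<bullet> h)\<^sup>2" using S2_inner_sq_less assms by blast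
  have nz: "center_vec g h \<noteq> 0" using center_vec_nonzero assms by blast
  have cr: "cross3 g h \<bullet> cross3 g h = 1 - (g \<bullet> h)\<^sup>2"
    using cross_norm[of g h] g h by (simp add: S2_inner_self[simplified])
  define E where "E = {q \<in> S2. g \<bullet> q = 0 \<and> h \<bullet> q = 0}"
  have E: "sph_bd (hemisphere g) \<inter> sph_bd (hemisphere h) = E"
    using sph_bd_hemisphere[OF g] sph_bd_hemisphere[OF h] by (auto simp: E_def)
  have S: "c \<in> semicircle (hemisphere g) (hemisphere h) \<longleftrightarrow> c \<in> S2 \<and> g \<bullet> c = 0 \<and> 0 \<le> h \<bullet> c" for c
    using sph_bd_hemisphere[OF g] hemisphere_eq[OF h] by (auto simp: semicircle_def)
  show ?thesis
    unfolding semicircle_center_def E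
  proof (rule the_equality)
    show "sgn (center_vec g h) \<in> semicircle (hemisphere g) (hemisphere h) \<and>
      (\<forall>e\<in>E. \<forall>e'\<in>E. sph_dist (sgn (center_vec g h)) e = sph_dist (sgn (center_vec g h)) e')"
    proof
      show "sgn (center_vec g h) \<in> semicircle (hemisphere g) (hemisphere h)"
        unfolding S using sgn_S2[OF nz] center_vec_orth[OF g, of h] center_vec_inner_other[OF g h] pos
        by (simp add: inner_commute[of _ "sgn (center_vec g h)"] sgn_inner)
      have "center_vec g h \<bullet> e = 0" if "e \<in> E" for e
        using that by (simp add: E_def center_vec_def inner_diff_left)
      then show "\<forall>e\<in>E. \<forall>e'\<in>E. sph_dist (sgn (center_vec g h)) e = sph_dist (sgn (center_vec g h)) e'"
        by (simp add: sph_dist_def sgn_inner)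
    qed
  next
    fix c
    assume a: "c \<in> semicircle (hemisphere g) (hemisphere h) \<and>
      (\<forall>e\<in>E. \<forall>e'\<in>E. sph_dist c e = sph_dist c e')"
    then have c: "c \<in> S2" "g \<bullet> c = 0" "0 \<le> h \<bullet> c" using S by auto
    let ?e = "sgn (cross3 g h)"
    have "cross3 g h \<noteq> 0" using cr pos by auto
    then have e: "?e \<in> E" "- ?e \<in> E"
      using sgn_S2[of "cross3 g h"]
      by (simp_all add: E_def inner_commute[of _ ?e] sgn_inner dot_cross_self norm_sgn)
    have "\<forall>e\<in>E. \<forall>e'\<in>E. sph_dist c e = sph_dist c e'" using a by blast
    from bspec[OF bspec[OF this e(1)] e(2)]
    have "arccos (c \<bullet> ?e) = arccos (c \<bullet> (- ?e))" unfolding sph_dist_def .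
    moreover have "\<bar>c \<bullet> ?e\<bar> \<le> 1"
      using Cauchy_Schwarz_ineq2[of c ?e] c(1) e(1) by (simp add: E_def)
    ultimately have "c \<bullet> ?e = c \<bullet> (- ?e)" using arccos_eq_iff[of "c \<bullet> ?e" "c \<bullet> (- ?e)"] by simp
    then have "c \<bullet> ?e = 0" by simp
    then have "triple g h c = 0"
      using \<open>cross3 g h \<noteq> 0\<close> by (simp add: inner_commute[of c] sgn_inner)
    then have "(1 - (g \<bullet> h)\<^sup>2) *\<^sub>R c = (h \<bullet> c) *\<^sub>R center_vec g h"
      using frame_expansion[of g h c] c g unfolding cr
      by (simp add: center_vec_def inner_commute S2_inner_self[simplified] scaleR_diff_right)
    then have "(1 / (1 - (g \<bullet> h)\<^sup>2)) *\<^sub>R ((1 - (g \<bullet> h)\<^sup>2) *\<^sub>R c)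
       = (1 / (1 - (g \<bullet> h)\<^sup>2)) *\<^sub>R ((h \<bullet> c) *\<^sub>R norm (center_vec g h) *\<^sub>R sgn (center_vec g h))"
      by (simp only: norm_scaleR_sgn)
    then have "c = ((h \<bullet> c) * norm (center_vec g h) / (1 - (g \<bullet> h)\<^sup>2)) *\<^sub>R sgn (center_vec g h)"
      using pos by simp
    moreover have "0 \<le> (h \<bullet> c) * norm (center_vec g h) / (1 - (g \<bullet> h)\<^sup>2)" using c(3) pos by simp
    ultimately show "c = sgn (center_vec g h)" using S2_eq_if_same_ray c(1) sgn_S2[OF nz] by blast
  qed
qed

lemma lune_thickness_eq:
  assumes g: "g \<in> S2" and h: "h \<in> S2" and ne: "g \<noteq> h" "g \<noteq> - h"
  shows "lune_thickness (hemisphere g) (hemisphere h) = arccos (- (g \<bullet> h))"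
proof -
  have ne': "h \<noteq> g" "h \<noteq> - g" using ne by auto
  have pos: "0 < 1 - (g \<bullet> h)\<^sup>2" using S2_inner_sq_less assms by blast
  have "(norm (center_vec g h))\<^sup>2 = (norm (center_vec h g))\<^sup>2"
    unfolding center_vec_norm[OF g h] center_vec_norm[OF h g] by (simp add: inner_commute)
  then have eq: "norm (center_vec h g) = norm (center_vec g h)"
    by (metis power2_eq_imp_eq norm_ge_zero)
  have "sgn (center_vec g h) \<bullet> sgn (center_vec h g) = (center_vec g h \<bullet> center_vec h g) / (norm (center_vec g h))\<^sup>2"
    by (simp add: sgn_div_norm eq power2_eq_square divide_inverse)
  also have "\<dots> = - (g \<bullet> h)" unfolding center_vec_inner_center_vec[OF g h] center_vec_norm[OF g h] using pos by simp
  finally show ?thesis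
    using semicircle_center_eq[OF g h ne] semicircle_center_eq[OF h g ne']
    by (simp add: lune_thickness_def sph_dist_def)
qed


lemma triple_cross_left: "triple (cross3 u v) p q = (p \<bullet> u) * (q \<bullet> v) - (p \<bullet> v) * (q \<bullet> u)"
  by (simp add: cross3_coordinates algebra_simps)

lemma cross_cross: "cross3 u (cross3 c u) = (u \<bullet> u) *\<^sub>R c - (u \<bullet> c) *\<^sub>R u"
  by (simp add: cross3_coordinates algebra_simps)

text \<open>Cramer's rule for four vectors in three dimensions; it replaces every argument about the cyclic
  position of four boundary points.\<close>

lemma four_vector_relation:
  "triple b c d *\<^sub>R a - triple a c d *\<^sub>R b + triple a b d *\<^sub>R c - triple a b c *\<^sub>R d = 0"
  by (simp add: cross3_coordinates algebra_simps)

text \<open>The product of two determinants is the determinant of the matrix of inner products.\<close>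

lemma gram_triple: "triple p x q * triple a e b =
    (p \<bullet> a) * ((x \<bullet> e) * (q \<bullet> b) - (x \<bullet> b) * (q \<bullet> e))
  - (p \<bullet> e) * ((x \<bullet> a) * (q \<bullet> b) - (x \<bullet> b) * (q \<bullet> a))
  + (p \<bullet> b) * ((x \<bullet> a) * (q \<bullet> e) - (x \<bullet> e) * (q \<bullet> a))"
  by (simp add: cross3_coordinates algebra_simps)

lemma dual_basis_expansion:
  "triple a e b *\<^sub>R z = (z \<bullet> a) *\<^sub>R cross3 e b + (z \<bullet> e) *\<^sub>R cross3 b a + (z \<bullet> b) *\<^sub>R cross3 a e"
  by (simp add: cross3_coordinates algebra_simps)

section \<open>Width and thickness in terms of the polar set\<close>

text \<open>The first order condition at a point \<open>y\<close> of the polar set farthest from \<open>x\<close>: moving \<open>y\<close> towards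
  \<open>z\<close> does not decrease the inner product with \<open>x\<close>. For \<open>x \<bullet> y < 0\<close> the norm in the normalization
  has to be bounded from above, which costs a second order term.\<close>

lemma minimizer_imp_dual:
  assumes C: "sph_convex_body C" and x: "x \<in> polar C" and y: "y \<in> polar C"
    and min: "\<forall>z\<in>polar C. x \<bullet> y \<le> x \<bullet> z" and z: "z \<in> dual_cone C"
  shows "0 \<le> center_vec y x \<bullet> z"
proof -
  let ?k = "x \<bullet> y"
  have yy: "y \<bullet> y = 1" using y body_polar_iff[OF C] S2_inner_self by blast
  have yd: "y \<in> dual_cone C" using y body_polar_iff[OF C] by blast
  have key: "?k * norm w \<le> x \<bullet> w" if "w \<in> dual_cone C" for w
  proof (cases "w = 0")
    case False
    then have "?k \<le> x \<bullet> sgn w" using min body_sgn_polar[OF C that] by blast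
    also have "\<dots> = (x \<bullet> w) / norm w" by (simp add: inner_commute[of x] sgn_inner)
    finally show ?thesis using False by (simp add: le_divide_eq)
  qed simp
  have *: "?k + e * (x \<bullet> z) \<ge> ?k * norm (y + e *\<^sub>R z)" if "0 < e" for e
    using key[of "y + e *\<^sub>R z"] dual_cone_comb[OF yd z, of 1 e] that by (simp add: inner_add_right)
  have "0 \<le> x \<bullet> z - ?k * (y \<bullet> z)"
  proof (cases "0 \<le> ?k")
    case True
    have "1 + y \<bullet> z \<le> norm (y + 1 *\<^sub>R z)"
      using norm_cauchy_schwarz[of y "y + z"] yy norm_eq_1[of y] by (simp add: inner_add_right)
    then have "?k * (1 + y \<bullet> z) \<le> ?k * norm (y + 1 *\<^sub>R z)" using True by (rule mult_left_mono)
    then show ?thesis using *[of 1] by (simp add: distrib_left)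
  next
    case False
    show ?thesis
    proof (rule ccontr)
      assume "\<not> ?thesis"
      then have d: "x \<bullet> z - ?k * (y \<bullet> z) < 0" by simp
      have zz: "0 \<le> z \<bullet> z" by simp
      \<comment> \<open>Small enough for the second order term not to compensate the negative first order term.\<close>
      define e where "e = - (x \<bullet> z - ?k * (y \<bullet> z)) / (1 + \<bar>?k\<bar> * (z \<bullet> z))"
      have e: "0 < e" unfolding e_def using d zz by (intro divide_pos_pos add_pos_nonneg) auto
      have "norm (y + e *\<^sub>R z) * 2 \<le> 1 + (norm (y + e *\<^sub>R z))\<^sup>2"
        using sum_squares_ge_zero[of "norm (y + e *\<^sub>R z) - 1" 0] by (simp add: power2_eq_square algebra_simps)
      also have "\<dots> = 2 * (1 + e * (y \<bullet> z) + e * e * (z \<bullet> z) / 2)"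
        unfolding dot_square_norm[symmetric]
        using yy by (simp add: inner_add_left inner_add_right inner_commute del: dot_square_norm power2_norm_eq_inner)
      finally have "norm (y + e *\<^sub>R z) \<le> 1 + e * (y \<bullet> z) + e * e * (z \<bullet> z) / 2"
        by (simp only: mult.commute[of _ 2] mult_le_cancel_left_pos zero_less_numeral)
      then have "?k * (1 + e * (y \<bullet> z) + e * e * (z \<bullet> z) / 2) \<le> ?k * norm (y + e *\<^sub>R z)"
        using False by (intro mult_left_mono_neg) auto
      then have "?k * (1 + e * (y \<bullet> z) + e * e * (z \<bullet> z) / 2) \<le> ?k + e * (x \<bullet> z)"
        using *[OF e] by linarith
      then have "0 \<le> e * (x \<bullet> z - ?k * (y \<bullet> z) - e * ?k * (z \<bullet> z) / 2)"
        by (simp add: algebra_simps)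
      then have 1: "0 \<le> x \<bullet> z - ?k * (y \<bullet> z) + e * \<bar>?k\<bar> * (z \<bullet> z) / 2"
        using e False by (simp add: zero_le_mult_iff)
      have "e * (1 + \<bar>?k\<bar> * (z \<bullet> z)) = - (x \<bullet> z - ?k * (y \<bullet> z))"
        unfolding e_def using zz
        by (metis add_pos_nonneg abs_ge_zero less_irrefl mult_nonneg_nonneg nonzero_eq_divide_eq zero_less_one)
      then have "e * (\<bar>?k\<bar> * (z \<bullet> z)) \<le> - (x \<bullet> z - ?k * (y \<bullet> z))" using e by (simp add: distrib_left)
      then show False using 1 d by simp
    qed
  qed
  then show ?thesis by (simp add: center_vec_def inner_diff_left inner_commute[of y x])
qed

lemma polar_ne_neg:
  assumes C: "sph_convex_body C" and "x \<in> polar C" "y \<in> polar C"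
  shows "x \<noteq> - y"
proof
  assume "x = - y"
  then have "y = 0" using dual_cone_pointed[OF C, of y] assms body_polar_iff[OF C] by auto
  then show False using assms(3) body_polar_iff[OF C] by auto
qed

lemma body_interior_polar:
  assumes C: "sph_convex_body C"
  obtains c where "c \<in> top_of_set S2 interior_of polar C" "c \<in> polar C"
proof -
  note F = body_facts[OF C]
  obtain x where x: "\<And>q. q \<in> C \<Longrightarrow> 0 < x \<bullet> q" using strictly_positive_functional[OF C] by blast
  have "x \<noteq> 0" using x F(4) by force
  then have "sgn x \<in> S2 \<and> (\<forall>q\<in>C. 0 < sgn x \<bullet> q)" using x sgn_S2 by (simp add: sgn_inner)
  then have *: "sgn x \<in> top_of_set S2 interior_of polar C" using interior_polar[OF F(5,3,4)] by blast
  show ?thesis by (rule that[OF * subsetD[OF interior_of_subset *]])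
qed

lemma polar_two_points:
  assumes C: "sph_convex_body C"
  obtains z where "z \<in> polar C" "z \<noteq> x"
proof -
  obtain c where c: "c \<in> top_of_set S2 interior_of polar C" "c \<in> polar C"
    using body_interior_polar[OF C] .
  obtain v :: "real^3" where v: "v \<noteq> 0" "orthogonal c v"
    using orthogonal_to_vector_exists[of c] by auto
  obtain e where e: "e > 0" "c + e *\<^sub>R v \<noteq> 0" "sgn (c + e *\<^sub>R v) \<in> polar C"
    using perturb_in_interior[OF polar_subset[OF body_facts(4)[OF C]] c(1)] by blast
  have "sgn (c + e *\<^sub>R v) \<bullet> v = e * (v \<bullet> v) / norm (c + e *\<^sub>R v)" "c \<bullet> v = 0"
    using v(2) by (simp_all add: sgn_inner inner_add_left orthogonal_def)
  moreover have "e * (v \<bullet> v) / norm (c + e *\<^sub>R v) > 0" using e v by simp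
  ultimately have "sgn (c + e *\<^sub>R v) \<noteq> c" by auto
  then show ?thesis using that[OF e(3)] that[OF c(2)] by metis
qed

lemma polar_minimizer_exists:
  assumes C: "sph_convex_body C"
  obtains y where "y \<in> polar C" "\<forall>z\<in>polar C. x \<bullet> y \<le> x \<bullet> z"
proof -
  obtain c where "c \<in> polar C" using body_interior_polar[OF C] .
  then have "polar C \<noteq> {}" by blast
  moreover have "continuous_on (polar C) (\<lambda>y. x \<bullet> y)" by (intro continuous_intros)
  ultimately obtain y where "y \<in> polar C" "\<forall>z\<in>polar C. x \<bullet> y \<le> x \<bullet> z"
    using continuous_attains_inf[OF compact_polar[OF body_facts(3,4)[OF C]]] by blast
  then show ?thesis using that by blast
qed

text \<open>By the bipolar theorem the first order condition says that the center of the semicircle on the side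
  of \<open>y\<close> lies in \<open>C\<close>. As it is orthogonal to \<open>y\<close>, the farthest point \<open>y\<close> is a boundary point, so
  \<open>H(y)\<close> supports \<open>C\<close>.\<close>

lemma minimizer_facts:
  assumes C: "sph_convex_body C" and x: "x \<in> polar C" and y: "y \<in> polar C"
    and min: "\<forall>z\<in>polar C. x \<bullet> y \<le> x \<bullet> z"
  shows "y \<noteq> x" "y \<noteq> - x" "sgn (center_vec y x) \<in> C" "y \<in> sph_bd (polar C)"
proof -
  have S: "x \<in> S2" "y \<in> S2" using x y body_polar_iff[OF C] by auto
  obtain z where z: "z \<in> polar C" "z \<noteq> x" using polar_two_points[OF C] .
  have "z \<in> S2" using z body_polar_iff[OF C] by auto
  then have "x \<bullet> z < 1" using S2_inner_less_one S z(2) by blast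
  then have "x \<bullet> y < 1" using bspec[OF min z(1)] by linarith
  then show ne: "y \<noteq> x" using S2_inner_self[OF S(1)] by auto
  show ne': "y \<noteq> - x" using polar_ne_neg[OF C y x] .
  have nz: "center_vec y x \<noteq> 0" using center_vec_nonzero S ne ne' by blast
  show c: "sgn (center_vec y x) \<in> C"
  proof (rule bipolar[OF C _ nz])
    fix z assume "z \<in> polar C"
    then have "z \<in> dual_cone C" using body_polar_iff[OF C] by blast
    then show "0 \<le> z \<bullet> center_vec y x" using minimizer_imp_dual[OF C x y min] by (simp add: inner_commute)
  qed
  have "y \<bullet> sgn (center_vec y x) = 0" using center_vec_orth[OF S(2)] by (simp add: inner_commute[of y] sgn_inner)
  then show "y \<in> sph_bd (polar C)"
    using sph_bd_polar[OF body_facts(5,3,4)[OF C]] y c by blast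
qed

lemma sph_bd_polar_subset: "sph_convex_body C \<Longrightarrow> sph_bd (polar C) \<subseteq> polar C"
  using sph_bd_polar[OF body_facts(5,3,4)] by blast

lemma arccos_neg_inner_le:
  assumes "x \<in> S2" "y \<in> S2" "z \<in> S2" "w \<in> S2"
  shows "arccos (- (x \<bullet> y)) \<le> arccos (- (z \<bullet> w)) \<longleftrightarrow> x \<bullet> y \<le> z \<bullet> w"
proof -
  have "\<bar>x \<bullet> y\<bar> \<le> 1" "\<bar>z \<bullet> w\<bar> \<le> 1"
    using Cauchy_Schwarz_ineq2[of x y] Cauchy_Schwarz_ineq2[of z w] assms by auto
  then show ?thesis using arccos_le_mono[of "- (x \<bullet> y)" "- (z \<bullet> w)"] by simp
qed

lemma lune_iff:
  assumes "x \<in> S2" "h \<in> S2"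
  shows "is_lune (hemisphere x) (hemisphere h) \<longleftrightarrow> x \<noteq> h \<and> x \<noteq> - h"
  using assms hemisphere_inj unfolding is_lune_def by metis

text \<open>Since the thickness of \<open>H(x) \<inter> H(h)\<close> is \<open>\<pi> - |xh|\<close>, choosing \<open>K\<^sup>*\<close> means choosing a point farthest from
  \<open>x\<close> among the boundary points of the polar set, and a farthest point of the whole polar set is
  automatically on its boundary.\<close>

lemma is_star_iff:
  assumes C: "sph_convex_body C" and x: "x \<in> polar C"
  shows "is_star C (hemisphere x) K' \<longleftrightarrow>
    (\<exists>y\<in>polar C. K' = hemisphere y \<and> (\<forall>z\<in>polar C. x \<bullet> y \<le> x \<bullet> z))"
proof -
  have xS: "x \<in> S2" and PS: "\<And>y. y \<in> polar C \<Longrightarrow> y \<in> S2" using x body_polar_iff[OF C] by auto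
  have cand: "supports H C \<and> is_lune (hemisphere x) H \<longleftrightarrow>
      (\<exists>h\<in>sph_bd (polar C). H = hemisphere h \<and> h \<noteq> x)" for H
  proof
    assume a: "supports H C \<and> is_lune (hemisphere x) H"
    then obtain h where h: "h \<in> S2" "H = hemisphere h" unfolding supports_def by blast
    then have "h \<in> sph_bd (polar C)" "x \<noteq> h" using a supports_iff[OF C] lune_iff[OF xS] by auto
    then show "\<exists>h\<in>sph_bd (polar C). H = hemisphere h \<and> h \<noteq> x" using h by blast
  next
    assume "\<exists>h\<in>sph_bd (polar C). H = hemisphere h \<and> h \<noteq> x"
    then obtain h where h: "h \<in> sph_bd (polar C)" "H = hemisphere h" "h \<noteq> x" by blast
    then have "h \<in> polar C" using sph_bd_polar_subset[OF C] by blast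
    then show "supports H C \<and> is_lune (hemisphere x) H"
      using h PS supports_iff[OF C] lune_iff[OF xS] polar_ne_neg[OF C x] by metis
  qed
  have th: "lune_thickness (hemisphere x) (hemisphere h) = arccos (- (x \<bullet> h))"
    if "h \<in> polar C" "h \<noteq> x" for h
    using lune_thickness_eq[OF xS PS[OF that(1)]] polar_ne_neg[OF C x that(1)] that(2) by auto
  have le: "lune_thickness (hemisphere x) (hemisphere h) \<le> lune_thickness (hemisphere x) (hemisphere h')
     \<longleftrightarrow> x \<bullet> h \<le> x \<bullet> h'"
    if "h \<in> polar C" "h \<noteq> x" "h' \<in> polar C" "h' \<noteq> x" for h h'
    unfolding th[OF that(1,2)] th[OF that(3,4)]
    using arccos_neg_inner_le[OF xS PS[OF that(1)] xS PS[OF that(3)]] .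
  obtain m where m: "m \<in> polar C" "\<forall>z\<in>polar C. x \<bullet> m \<le> x \<bullet> z"
    using polar_minimizer_exists[OF C, of x] .
  note mf = minimizer_facts[OF C x m]
  show ?thesis
  proof
    assume "is_star C (hemisphere x) K'"
    then have a: "supports K' C \<and> is_lune (hemisphere x) K'"
      "\<And>H. supports H C \<and> is_lune (hemisphere x) H \<Longrightarrow>
        lune_thickness (hemisphere x) K' \<le> lune_thickness (hemisphere x) H"
      by (auto simp: is_star_def is_arg_min_linorder)
    then obtain h where h: "h \<in> sph_bd (polar C)" "K' = hemisphere h" "h \<noteq> x" using cand by blast
    have hp: "h \<in> polar C" using h sph_bd_polar_subset[OF C] by blast
    have "supports (hemisphere m) C \<and> is_lune (hemisphere x) (hemisphere m)"
      using cand mf(1,4) by blast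
    then have "x \<bullet> h \<le> x \<bullet> m" using a(2) le[OF hp h(3) m(1) mf(1)] h(2) by blast
    then show "\<exists>y\<in>polar C. K' = hemisphere y \<and> (\<forall>z\<in>polar C. x \<bullet> y \<le> x \<bullet> z)"
      using hp h(2) m(2) by force
  next
    assume "\<exists>y\<in>polar C. K' = hemisphere y \<and> (\<forall>z\<in>polar C. x \<bullet> y \<le> x \<bullet> z)"
    then obtain y where y: "y \<in> polar C" "K' = hemisphere y" "\<forall>z\<in>polar C. x \<bullet> y \<le> x \<bullet> z"
      by blast
    note yf = minimizer_facts[OF C x y(1,3)]
    show "is_star C (hemisphere x) K'"
      unfolding is_star_def is_arg_min_linorder
    proof (intro conjI allI impI)
      have "supports K' C \<and> is_lune (hemisphere x) K'" using cand yf(1,4) y(2) by blast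
      then show "supports K' C" "is_lune (hemisphere x) K'" by auto
      fix H assume "supports H C \<and> is_lune (hemisphere x) H"
      then obtain h where h: "h \<in> sph_bd (polar C)" "H = hemisphere h" "h \<noteq> x" using cand by blast
      have hp: "h \<in> polar C" using h sph_bd_polar_subset[OF C] by blast
      show "lune_thickness (hemisphere x) K' \<le> lune_thickness (hemisphere x) H"
        unfolding h(2) y(2) using le[OF y(1) yf(1) hp h(3)] bspec[OF y(3) hp] by blast
    qed
  qed
qed

lemma width_eq:
  assumes C: "sph_convex_body C" and x: "x \<in> polar C" and y: "y \<in> polar C"
    and min: "\<forall>z\<in>polar C. x \<bullet> y \<le> x \<bullet> z"
  shows "width C (hemisphere x) = arccos (- (x \<bullet> y))"
proof -
  have th: "lune_thickness (hemisphere x) (hemisphere h) = arccos (- (x \<bullet> y))"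
    if "h \<in> polar C" "\<forall>z\<in>polar C. x \<bullet> h \<le> x \<bullet> z" for h
  proof -
    have "x \<bullet> h = x \<bullet> y" using that min y by (meson order_antisym)
    moreover have "h \<noteq> x" "x \<noteq> - h" using minimizer_facts[OF C x that] by auto
    ultimately show ?thesis
      using lune_thickness_eq[of x h] x that(1) body_polar_iff[OF C] by auto
  qed
  show ?thesis unfolding width_def
  proof (rule the_equality)
    show "\<exists>K'. is_star C (hemisphere x) K' \<and> arccos (- (x \<bullet> y)) = lune_thickness (hemisphere x) K'"
      using is_star_iff[OF C x] th[OF y min] y min by metis
  next
    fix w assume "\<exists>K'. is_star C (hemisphere x) K' \<and> w = lune_thickness (hemisphere x) K'"
    then show "w = arccos (- (x \<bullet> y))" using is_star_iff[OF C x] th by metis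
  qed
qed

text \<open>The endpoints of a diametral chord of the polar set, that is, the centers of the two hemispheres
  bounding a lune of thickness \<open>\<Delta>(C)\<close>.\<close>

definition extremal_pair :: "(real^3) set \<Rightarrow> real^3 \<Rightarrow> real^3 \<Rightarrow> bool" where
  "extremal_pair C x y \<longleftrightarrow> x \<in> polar C \<and> y \<in> polar C \<and>
     (\<forall>x'\<in>polar C. \<forall>y'\<in>polar C. x \<bullet> y \<le> x' \<bullet> y')"

lemma extremal_pairD:
  assumes "extremal_pair C x y"
  shows "x \<in> polar C" "y \<in> polar C" "\<And>x' y'. x' \<in> polar C \<Longrightarrow> y' \<in> polar C \<Longrightarrow> x \<bullet> y \<le> x' \<bullet> y'"
  using assms by (auto simp: extremal_pair_def)

lemma extremal_pair_commute: "extremal_pair C x y \<Longrightarrow> extremal_pair C y x"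
  by (auto simp: extremal_pair_def inner_commute)

lemma extremal_pair_exists:
  assumes C: "sph_convex_body C"
  obtains x y where "extremal_pair C x y"
proof -
  let ?P = "polar C"
  obtain c where "c \<in> ?P" using body_interior_polar[OF C] .
  then have "?P \<times> ?P \<noteq> {}" by blast
  moreover have "compact (?P \<times> ?P)" using compact_polar[OF body_facts(3,4)[OF C]] compact_Times by blast
  moreover have "continuous_on (?P \<times> ?P) (\<lambda>z. fst z \<bullet> snd z)" by (intro continuous_intros)
  ultimately obtain z where "z \<in> ?P \<times> ?P" "\<forall>w\<in>?P \<times> ?P. fst z \<bullet> snd z \<le> fst w \<bullet> snd w"
    using continuous_attains_inf[of "?P \<times> ?P" "\<lambda>z. fst z \<bullet> snd z"] by blast
  then have "extremal_pair C (fst z) (snd z)" by (force simp: extremal_pair_def)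
  then show ?thesis using that by blast
qed

lemma thickness_eq:
  assumes C: "sph_convex_body C" and xy: "extremal_pair C x y"
  shows "thickness C = arccos (- (x \<bullet> y))"
proof -
  note D = extremal_pairD[OF xy] note D' = extremal_pairD[OF extremal_pair_commute[OF xy]]
  have PS: "y \<in> S2" if "y \<in> polar C" for y using that body_polar_iff[OF C] by auto
  show ?thesis unfolding thickness_def
  proof (rule Least_equality)
    have "x \<in> sph_bd (polar C)" using minimizer_facts(4)[OF C D'(1,2)] D'(3)[OF D(2)] by blast
    then have "supports (hemisphere x) C" using supports_iff[OF C PS[OF D(1)]] by blast
    then show "\<exists>K. supports K C \<and> arccos (- (x \<bullet> y)) = width C K"
      using width_eq[OF C D(1,2)] D(3)[OF D(1)] by auto
  next
    fix w assume "\<exists>K. supports K C \<and> w = width C K"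
    then obtain K where K: "supports K C" "w = width C K" by blast
    then obtain m where m: "m \<in> S2" "K = hemisphere m" unfolding supports_def by blast
    then have mp: "m \<in> polar C" using K(1) supports_iff[OF C] sph_bd_polar_subset[OF C] by blast
    obtain n where n: "n \<in> polar C" "\<forall>z\<in>polar C. m \<bullet> n \<le> m \<bullet> z"
      using polar_minimizer_exists[OF C, of m] .
    have "w = arccos (- (m \<bullet> n))" using K m width_eq[OF C mp n] by blast
    then show "arccos (- (x \<bullet> y)) \<le> w"
      using arccos_neg_inner_le[of x y m n] PS D(1,2) mp n(1) D(3)[OF mp n(1)] by blast
  qed
qed

lemma extremal_pair_facts:
  assumes C: "sph_convex_body C" and xy: "extremal_pair C x y"
  shows "x \<noteq> y" "x \<noteq> - y" "sgn (center_vec x y) \<in> C" "x \<in> sph_bd (polar C)"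
   "z \<in> dual_cone C \<Longrightarrow> 0 \<le> center_vec x y \<bullet> z"
proof -
  note D = extremal_pairD[OF xy] note D' = extremal_pairD[OF extremal_pair_commute[OF xy]]
  have m: "\<forall>z\<in>polar C. y \<bullet> x \<le> y \<bullet> z" using D'(3) D(2) by blast
  show "x \<noteq> y" "x \<noteq> - y" "sgn (center_vec x y) \<in> C" "x \<in> sph_bd (polar C)"
    using minimizer_facts[OF C D'(1,2) m] .
  show "z \<in> dual_cone C \<Longrightarrow> 0 \<le> center_vec x y \<bullet> z"
    using minimizer_imp_dual[OF C D'(1,2) m] .
qed

section \<open>Positively oriented boundary curves\<close>

lemma closed_sph_bd: "closed (sph_bd C)"
  unfolding sph_bd_def
  by (rule closedin_closed_trans[OF closedin_frontier_of]) simp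

text \<open>Seen from an interior point \<open>c\<close>, every direction in the tangent plane meets the boundary of the polar
  set exactly once. The direction map is therefore a homeomorphism from the boundary onto the circle,
  and its inverse, run through counterclockwise from the direction of \<open>m1\<close>, is the required curve; its
  projection is homotopic to the unit circle along radii. Both determinants being positive, the
  angles from \<open>m1\<close> to \<open>m\<close> and from \<open>m\<close> to \<open>m2\<close> lie below \<open>\<pi>\<close>, so that \<open>m2\<close> is reached within one turn.\<close>

lemma positive_boundary_curve_through:
  assumes C: "sph_convex_body C" and c: "c \<in> S2" "\<And>p. p \<in> C \<Longrightarrow> 0 < c \<bullet> p"
    and m: "m1 \<in> sph_bd (polar C)" "m \<in> sph_bd (polar C)" "m2 \<in> sph_bd (polar C)"
    and or: "0 < triple c m1 m" "0 < triple c m m2"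
  obtains \<gamma> s t where "positive_boundary_curve \<gamma> (polar C)" "0 < s" "s < t" "t < 1"
    "\<gamma> 0 = m1" "\<gamma> s = m" "\<gamma> t = m2"
proof -
  note F = body_facts[OF C]
  let ?B = "sph_bd (polar C)"
  have B: "x \<in> ?B \<longleftrightarrow> x \<in> S2 \<and> x \<in> dual_cone C \<and> (\<exists>p\<in>C. x \<bullet> p = 0)" for x
    using sph_bd_polar[OF F(5,3,4)] body_polar_iff[OF C] by blast
  have B_S2: "x \<in> S2" and B_dual: "x \<in> dual_cone C" and B_ex: "\<exists>p\<in>C. x \<bullet> p = 0" if "x \<in> ?B" for x
    using that unfolding B by blast+
  have cc: "c \<bullet> c = 1" using c(1) S2_inner_self by blast
  have m1: "m1 \<in> S2" using B_S2[OF m(1)] .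
  have "center_vec c m1 \<noteq> 0"
  proof
    assume "center_vec c m1 = 0"
    then have "m1 = (c \<bullet> m1) *\<^sub>R c" by (simp add: center_vec_def)
    then have "cross3 c m1 = 0" by (metis cross_mult_right cross_refl scaleR_zero_right)
    then show False using or(1) by simp
  qed
  define N where "N = norm (center_vec c m1)"
  have N: "0 < N" using \<open>center_vec c m1 \<noteq> 0\<close> by (simp add: N_def)
  define u where "u = sgn (center_vec c m1)"
  define v where "v = cross3 c u"
  have u: "norm u = 1" "u \<bullet> u = 1" "u \<bullet> c = 0"
    using \<open>center_vec c m1 \<noteq> 0\<close> center_vec_orth[OF c(1), of m1] S2_inner_self[OF sgn_S2[of "center_vec c m1"]]
    by (simp_all add: u_def norm_sgn) (simp add: sgn_inner)
  have v: "v \<bullet> v = 1" "norm v = 1" "u \<bullet> v = 0" "v \<bullet> c = 0"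
    using cross_norm[of c u] cc u norm_eq_1[of "cross3 c u"]
    by (simp_all add: v_def dot_cross_self inner_commute[of c u])
  have uv: "cross3 u v = c" using cross_cross[of u c] u by (simp add: v_def)
  have expand: "w = (w \<bullet> u) *\<^sub>R u + (w \<bullet> v) *\<^sub>R v + (w \<bullet> c) *\<^sub>R c" for w
    using frame_expansion[of u v w] cross_norm[of u v] u v
    by (simp add: uv cc inner_commute[of c w])
  have tr: "triple c p q = (p \<bullet> u) * (q \<bullet> v) - (p \<bullet> v) * (q \<bullet> u)" for p q
    unfolding uv[symmetric] by (rule triple_cross_left)
  \<comment> \<open>The projection along c to the tangent plane in the frame u, v.\<close>
  define \<zeta> where "\<zeta> = (\<lambda>q. Complex (q \<bullet> u) (q \<bullet> v))"
  have \<zeta>_lin: "\<zeta> (r *\<^sub>R q) = r *\<^sub>R \<zeta> q" for r q by (simp add: \<zeta>_def complex_eq_iff)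
  have \<zeta>_cont: "continuous_on S \<zeta>" for S unfolding \<zeta>_def by (intro continuous_intros)
  have \<zeta>_nz: "\<zeta> q \<noteq> 0" if qB: "q \<in> ?B" for q
  proof
    assume "\<zeta> q = 0"
    then have *: "q = (q \<bullet> c) *\<^sub>R c" using expand[of q] by (simp add: \<zeta>_def complex_eq_iff)
    obtain p where p: "p \<in> C" "q \<bullet> p = 0" using B_ex[OF qB] by blast
    have "(q \<bullet> c) * (c \<bullet> p) = 0" using p(2) arg_cong[OF *, of "\<lambda>w. w \<bullet> p"] by simp
    then have "q \<bullet> c = 0" using c(2)[OF p(1)] by simp
    then have "q = 0" using * by (metis scaleR_zero_left)
    then show False using B_S2[OF qB] by simp
  qed
  define h where "h = (\<lambda>q. sgn (\<zeta> q))"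
  have h_cont: "continuous_on ?B h" unfolding h_def
    by (intro continuous_on_sgn \<zeta>_cont) (use \<zeta>_nz in blast)
  \<comment> \<open>Two boundary points in the same direction differ by a multiple of c after scaling; the one with the larger share of c would be interior.\<close>
  have key: "q = q'" if q: "q \<in> ?B" "q' \<in> ?B" "h q = h q'"
    and le: "(q' \<bullet> c) / norm (\<zeta> q') \<le> (q \<bullet> c) / norm (\<zeta> q)" for q q'
  proof -
    let ?b = "norm (\<zeta> q)" let ?b' = "norm (\<zeta> q')"
    have pos: "0 < ?b" "0 < ?b'" using \<zeta>_nz q by auto
    define l where "l = (q \<bullet> c) / ?b - (q' \<bullet> c) / ?b'"
    have "\<zeta> q /\<^sub>R ?b = \<zeta> q' /\<^sub>R ?b'" using q(3) by (simp add: h_def sgn_div_norm)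
    then have "(q \<bullet> u) / ?b = (q' \<bullet> u) / ?b'" "(q \<bullet> v) / ?b = (q' \<bullet> v) / ?b'"
      by (simp_all add: \<zeta>_def complex_eq_iff divide_inverse mult.commute)
    then have "(1/?b) *\<^sub>R q - (1/?b') *\<^sub>R q' = l *\<^sub>R c"
      using expand[of "(1/?b) *\<^sub>R q - (1/?b') *\<^sub>R q'"] by (simp add: inner_diff_left l_def)
    then have eq: "(1/?b) *\<^sub>R q = (1/?b') *\<^sub>R q' + l *\<^sub>R c" by (simp add: algebra_simps)
    obtain p where p: "p \<in> C" "q \<bullet> p = 0" using B_ex[OF q(1)] by blast
    have "((1/?b) *\<^sub>R q) \<bullet> p = ((1/?b') *\<^sub>R q' + l *\<^sub>R c) \<bullet> p" using eq by simp
    then have "0 = (q' \<bullet> p) / ?b' + l * (c \<bullet> p)" using p(2) by (simp add: inner_add_left)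
    moreover have "0 \<le> (q' \<bullet> p) / ?b'" using pos dual_coneD[OF B_dual[OF q(2)] p(1)] by simp
    moreover have "0 \<le> l" using le by (simp add: l_def)
    moreover have "0 < c \<bullet> p" using c(2) p(1) by blast
    ultimately have "l = 0" by (metis add_nonneg_pos less_irrefl mult_pos_pos order_less_le)
    then have "?b *\<^sub>R ((1/?b) *\<^sub>R q) = ?b *\<^sub>R ((1/?b') *\<^sub>R q')" using eq by simp
    then have "q = (?b/?b') *\<^sub>R q'" using pos by simp
    moreover have "0 \<le> ?b/?b'" by simp
    ultimately show "q = q'" using S2_eq_if_same_ray[OF B_S2[OF q(1)] B_S2[OF q(2)]] by blast
  qed
  have h_inj: "inj_on h ?B"
  proof (rule inj_onI)
    fix q q' assume "q \<in> ?B" "q' \<in> ?B" "h q = h q'"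
    then show "q = q'" using key[of q q'] key[of q' q] by (metis linear)
  qed
  have h_surj: "h ` ?B = sphere 0 1"
  proof
    show "h ` ?B \<subseteq> sphere 0 1" using \<zeta>_nz by (auto simp: h_def norm_sgn)
    show "sphere 0 1 \<subseteq> h ` ?B"
    proof
      fix w :: complex assume w: "w \<in> sphere 0 1"
      define d where "d = Re w *\<^sub>R u + Im w *\<^sub>R v"
      have "continuous_on C (\<lambda>p. (d \<bullet> p) / (c \<bullet> p))"
        by (intro continuous_intros) (use c(2) in force)
      then obtain p where p: "p \<in> C" "\<forall>q\<in>C. (d \<bullet> p) / (c \<bullet> p) \<le> (d \<bullet> q) / (c \<bullet> q)"
        using continuous_attains_inf[OF F(5,4)] by blast
      \<comment> \<open>The last vector of the dual cone on the line through d in direction -c.\<close>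
      define x where "x = d - ((d \<bullet> p) / (c \<bullet> p)) *\<^sub>R c"
      have "0 \<le> x \<bullet> q" if "q \<in> C" for q
      proof -
        have "(d \<bullet> p) / (c \<bullet> p) * (c \<bullet> q) \<le> d \<bullet> q"
          using bspec[OF p(2) that] c(2)[OF that] by (simp add: le_divide_eq)
        then show ?thesis by (simp add: x_def inner_diff_left)
      qed
      then have xd: "x \<in> dual_cone C" by (simp add: dual_cone_def)
      have xp: "x \<bullet> p = 0" using c(2)[OF p(1)] by (simp add: x_def inner_diff_left)
      have "x \<bullet> u = Re w" "x \<bullet> v = Im w"
        using u v by (simp_all add: x_def d_def inner_diff_left inner_add_left inner_commute[of c]
          inner_commute[of v u])
      then have \<zeta>x: "\<zeta> x = w" by (simp add: \<zeta>_def)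
      moreover have "\<zeta> 0 = 0" by (simp add: \<zeta>_def complex_eq_iff)
      ultimately have "x \<noteq> 0" using w by auto
      then have "sgn x \<in> ?B" unfolding B using sgn_S2 sgn_dual_cone[OF xd] xp p(1)
        by (auto simp: sgn_inner)
      moreover have "h (sgn x) = w"
        using w \<open>x \<noteq> 0\<close> by (simp add: h_def sgn_div_norm \<zeta>_lin \<zeta>x)
      ultimately show "w \<in> h ` ?B" by blast
    qed
  qed
  have "compact ?B"
    using closed_sph_bd compact_polar[OF F(3,4)] sph_bd_polar_subset[OF C]
    by (metis compact_Int_closed inf.absorb_iff2)
  define k where "k = the_inv_into ?B h"
  have k_cont: "continuous_on (sphere 0 1) k"
    using continuous_on_inv_into[OF h_cont \<open>compact ?B\<close> h_inj] h_surj by (simp add: k_def)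
  have k_inj: "inj_on k (sphere 0 1)" unfolding k_def h_surj[symmetric] by (rule inj_on_the_inv_into[OF h_inj])
  have k_img: "k ` sphere 0 1 = ?B"
    unfolding k_def h_surj[symmetric] by (rule the_inv_into_onto[OF h_inj])
  have kh: "k (sgn (\<zeta> q)) = q" if "q \<in> ?B" for q
    using the_inv_into_f_f[OF h_inj that] by (simp add: k_def h_def)
  have hk: "sgn (\<zeta> (k w)) = w" "k w \<in> ?B" if "w \<in> sphere 0 1" for w
  proof -
    have w: "w \<in> h ` ?B" using that h_surj by blast
    show "sgn (\<zeta> (k w)) = w" using f_the_inv_into_f[OF h_inj w] by (simp add: k_def h_def)
    show "k w \<in> ?B" using the_inv_into_into[OF h_inj w subset_refl] by (simp add: k_def)
  qed
  define \<gamma> where "\<gamma> = k \<circ> circlepath 0 1"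
  have pc: "path_image (circlepath (0::complex) 1) = sphere 0 1" by simp
  have \<gamma>_simple: "simple_path \<gamma>" unfolding \<gamma>_def
    by (rule simple_path_continuous_image) (simp_all add: simple_path_circlepath k_cont k_inj)
  have \<gamma>_loop: "pathfinish \<gamma> = pathstart \<gamma>" by (simp add: \<gamma>_def pathfinish_compose pathstart_compose)
  have \<gamma>_img: "path_image \<gamma> = ?B" by (simp add: \<gamma>_def path_image_compose k_img)
  have "winding_number (\<lambda>t. \<zeta> (\<gamma> t)) 0 = 1"
  proof -
    have "homotopic_loops (- {0}) (circlepath 0 1) (\<lambda>t. \<zeta> (\<gamma> t))"
    proof (rule homotopic_loops_linear)
      show "path (circlepath (0::complex) 1)" by simp
      show "path (\<lambda>t. \<zeta> (\<gamma> t))"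
        using path_continuous_image[OF simple_path_imp_path[OF \<gamma>_simple] \<zeta>_cont] by (simp add: o_def)
      show "pathfinish (circlepath (0::complex) 1) = pathstart (circlepath 0 1)" by simp
      show "pathfinish (\<lambda>t. \<zeta> (\<gamma> t)) = pathstart (\<lambda>t. \<zeta> (\<gamma> t))"
        using \<gamma>_loop by (simp add: pathfinish_def pathstart_def)
      fix t :: real assume t: "t \<in> {0..1}"
      define w where "w = circlepath (0::complex) 1 t"
      have w: "w \<in> sphere 0 1" using t pc by (auto simp: w_def path_image_def)
      have eq: "\<zeta> (\<gamma> t) = norm (\<zeta> (\<gamma> t)) *\<^sub>R w"
        using norm_scaleR_sgn[of "\<zeta> (\<gamma> t)"] hk(1)[OF w] by (simp add: \<gamma>_def w_def)
      have "0 \<notin> closed_segment w (\<zeta> (\<gamma> t))"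
      proof
        assume "0 \<in> closed_segment w (\<zeta> (\<gamma> t))"
        then obtain r where r: "0 \<le> r" "r \<le> 1" "0 = (1 - r) *\<^sub>R w + r *\<^sub>R \<zeta> (\<gamma> t)"
          by (auto simp: closed_segment_def)
        have "0 = ((1 - r) + r * norm (\<zeta> (\<gamma> t))) *\<^sub>R w"
          using r(3) eq by (metis scaleR_add_left scaleR_scaleR)
        then have 0: "(1 - r) + r * norm (\<zeta> (\<gamma> t)) = 0" using w by auto
        have "0 < norm (\<zeta> (\<gamma> t))" using \<zeta>_nz[OF hk(2)[OF w]] by (simp add: \<gamma>_def w_def)
        then have "0 < (1 - r) + r * norm (\<zeta> (\<gamma> t))" using r by (cases "r = 0") (auto intro: add_nonneg_pos)
        then show False using 0 by simp
      qed
      then show "closed_segment (circlepath 0 1 t) (\<zeta> (\<gamma> t)) \<subseteq> - {0}" by (auto simp: w_def)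
    qed
    then show ?thesis
      using winding_number_homotopic_loops winding_number_circlepath_centre[of 1 0] by fastforce
  qed
  moreover have "c \<in> top_of_set S2 interior_of polar C"
    using interior_polar[OF F(5,3,4)] c by blast
  ultimately have pbc: "positive_boundary_curve \<gamma> (polar C)"
    unfolding positive_boundary_curve_def \<zeta>_def using \<gamma>_simple \<gamma>_loop \<gamma>_img u(1) v(2,3) uv by blast
  have \<gamma>_cis: "\<gamma> (r / (2 * pi)) = k (cis r)" for r
    by (simp add: \<gamma>_def circlepath cis_conv_exp mult.commute)
  have m1u: "m1 \<bullet> u = N" "m1 \<bullet> v = 0"
  proof -
    have e: "m1 = N *\<^sub>R u + (c \<bullet> m1) *\<^sub>R c" by (simp add: N_def u_def norm_scaleR_sgn center_vec_def)
    show "m1 \<bullet> u = N" by (subst e) (simp add: inner_add_left u inner_commute[of c u])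
    show "m1 \<bullet> v = 0" by (subst e) (simp add: inner_add_left v inner_commute[of c v])
  qed
  have "sgn (\<zeta> m1) = cis 0"
    using N by (simp add: \<zeta>_def m1u complex_eq_iff sgn_div_norm norm_complex_def)
  then have g1: "\<gamma> 0 = m1" using kh[OF m(1)] \<gamma>_cis[of 0] by simp
  define \<phi> where "\<phi> = Arg (\<zeta> m)"
  define \<psi> where "\<psi> = Arg (\<zeta> m2 / \<zeta> m)"
  have "0 < m \<bullet> v" using or(1) N by (simp add: tr m1u zero_less_mult_iff)
  then have \<phi>: "0 < \<phi>" "\<phi> < pi" using Arg_lt_pi[of "\<zeta> m"] by (simp_all add: \<phi>_def \<zeta>_def)
  have "Im (\<zeta> m2 / \<zeta> m) = triple c m m2 / (norm (\<zeta> m))\<^sup>2"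
    unfolding tr cmod_power2 by (simp add: Im_divide \<zeta>_def algebra_simps)
  then have "0 < Im (\<zeta> m2 / \<zeta> m)" using or(2) \<zeta>_nz[OF m(2)] by simp
  then have \<psi>: "0 < \<psi>" "\<psi> < pi" using Arg_lt_pi[of "\<zeta> m2 / \<zeta> m"] by (simp_all add: \<psi>_def)
  have c1: "cis \<phi> = sgn (\<zeta> m)" using cis_Arg[OF \<zeta>_nz[OF m(2)]] by (simp add: \<phi>_def)
  have "\<zeta> m2 / \<zeta> m \<noteq> 0" using \<zeta>_nz m by simp
  then have "cis \<psi> = sgn (\<zeta> m2 / \<zeta> m)" using cis_Arg by (simp add: \<psi>_def)
  then have "cis (\<phi> + \<psi>) = sgn (\<zeta> m * (\<zeta> m2 / \<zeta> m))" using c1 by (simp only: sgn_mult flip: cis_mult)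
  then have c2: "cis (\<phi> + \<psi>) = sgn (\<zeta> m2)" using \<zeta>_nz[OF m(2)] by simp
  have g2: "\<gamma> (\<phi> / (2 * pi)) = m" using \<gamma>_cis c1 kh[OF m(2)] by simp
  have g3: "\<gamma> ((\<phi> + \<psi>) / (2 * pi)) = m2" using \<gamma>_cis c2 kh[OF m(3)] by simp
  show ?thesis
  proof (rule that[OF pbc _ _ _ g1 g2 g3])
    show "0 < \<phi> / (2 * pi)" "\<phi> / (2 * pi) < (\<phi> + \<psi>) / (2 * pi)" "(\<phi> + \<psi>) / (2 * pi) < 1"
      using \<phi> \<psi> by (simp_all add: divide_strict_right_mono)
  qed
qed

section \<open>Diametral chords of the polar set\<close>

lemma extremal_pair_bound:
  assumes C: "sph_convex_body C" and xy: "extremal_pair C x y" and uv: "u \<in> dual_cone C" "v \<in> dual_cone C"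
  shows "(x \<bullet> y) * (norm u * norm v) \<le> u \<bullet> v"
proof (cases "u = 0 \<or> v = 0")
  case False
  then have "x \<bullet> y \<le> sgn u \<bullet> sgn v"
    using extremal_pairD(3)[OF xy] body_sgn_polar[OF C uv(1)] body_sgn_polar[OF C uv(2)] by blast
  also have "\<dots> = (u \<bullet> v) / (norm u * norm v)" by (simp add: sgn_div_norm divide_inverse)
  finally show ?thesis using False by (simp add: le_divide_eq)
qed auto

lemma extremal_pair_S2:
  assumes "sph_convex_body C" "extremal_pair C x y"
  shows "x \<in> S2" "y \<in> S2" "x \<in> dual_cone C" "y \<in> dual_cone C" "x \<bullet> x = 1" "y \<bullet> y = 1"
  using assms extremal_pairD[OF assms(2)] body_polar_iff[OF assms(1)] S2_inner_self by blast+

lemma extremal_pair_same_inner: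
  assumes "extremal_pair C x y" "extremal_pair C x' y'" shows "x' \<bullet> y' = x \<bullet> y"
  using extremal_pairD[OF assms(1)] extremal_pairD[OF assms(2)] by (meson order_antisym)

lemma extremal_pair_square: 
  assumes "sph_convex_body C" "extremal_pair C x y" shows "0 < 1 - (x \<bullet> y)\<^sup>2"
  using S2_inner_sq_less extremal_pair_facts(1,2)[OF assms] extremal_pair_S2[OF assms] by blast

lemma unit_frame_expansion:
  assumes "x \<in> S2" "y \<in> S2"
  shows "(1 - (x \<bullet> y)\<^sup>2) *\<^sub>R w = (center_vec y x \<bullet> w) *\<^sub>R x + (center_vec x y \<bullet> w) *\<^sub>R y + (triple x y w) *\<^sub>R cross3 x y"
proof -
  have 1: "x \<bullet> x = 1" "y \<bullet> y = 1" using assms S2_inner_self by blast+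
  then show ?thesis
    using frame_expansion[of x y w] cross_norm[of x y]
    by (simp add: center_vec_def inner_diff_left inner_commute[of y x] inner_commute[of w] mult.commute)
qed

text \<open>Different diametral chords cross properly. The projections of \<open>x'\<close> and \<open>y'\<close> to the plane of \<open>x\<close> and
  \<open>y\<close> lie in the cone spanned by \<open>x\<close> and \<open>y\<close>, which is dual to the two center vectors, so the angle
  between these projections is at most the diametral angle. If \<open>x'\<close> and \<open>y'\<close> were on the same side of
  the plane, their components along \<open>x \<times> y\<close> could only bring them closer to each other; as the angle is
  obtuse, they attain the diametral distance only inside the plane.\<close>

lemma extremal_pairs_cross:
  assumes C: "sph_convex_body C" and xy: "extremal_pair C x y" and xy': "extremal_pair C x' y'"
    and neg: "x \<bullet> y < 0"
  shows "triple x y x' * triple x y y' < 0 \<or> (x' = x \<and> y' = y) \<or> (x' = y \<and> y' = x)"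
proof (cases "triple x y x' * triple x y y' < 0")
  case False
  note S = extremal_pair_S2[OF C xy] note S' = extremal_pair_S2[OF C xy']
  define k where "k = x \<bullet> y"
  define s where "s = 1 - k\<^sup>2"
  define n where "n = cross3 x y"
  define h where "h = triple x y x'"
  define g where "g = triple x y y'"
  define a where "a = center_vec y x \<bullet> x'" define b where "b = center_vec x y \<bullet> x'"
  define a' where "a' = center_vec y x \<bullet> y'" define b' where "b' = center_vec x y \<bullet> y'"
  have k': "x' \<bullet> y' = k" using extremal_pair_same_inner[OF xy xy'] by (simp add: k_def)
  have s: "0 < s" using extremal_pair_square[OF C xy] by (simp add: s_def k_def)
  have nn: "n \<bullet> n = s" "n \<bullet> x = 0" "n \<bullet> y = 0" "x \<bullet> n = 0" "y \<bullet> n = 0"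
    using cross_norm[of x y] S by (simp_all add: n_def s_def k_def dot_cross_self)
  have nonneg: "0 \<le> a" "0 \<le> b" "0 \<le> a'" "0 \<le> b'"
    unfolding a_def b_def a'_def b'_def
    using extremal_pair_facts(5)[OF C xy] extremal_pair_facts(5)[OF C extremal_pair_commute[OF xy]] S' by auto
  \<comment> \<open>The projections of s x' and s y' to the plane of x and y.\<close>
  define u where "u = a *\<^sub>R x + b *\<^sub>R y"
  define v where "v = a' *\<^sub>R x + b' *\<^sub>R y"
  have ex: "s *\<^sub>R x' = u + h *\<^sub>R n" "s *\<^sub>R y' = v + g *\<^sub>R n"
    using unit_frame_expansion[OF S(1,2), of x'] unit_frame_expansion[OF S(1,2), of y']
    by (simp_all add: s_def k_def u_def v_def a_def b_def a'_def b'_def h_def g_def n_def)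
  have un: "u \<bullet> n = 0" "v \<bullet> n = 0" "n \<bullet> u = 0" "n \<bullet> v = 0"
    using nn by (simp_all add: u_def v_def inner_add_left inner_add_right)
  have "(s *\<^sub>R x') \<bullet> (s *\<^sub>R y') = u \<bullet> v + h * g * s"
    unfolding ex using un nn by (simp add: inner_add_left inner_add_right)
  then have uv: "u \<bullet> v = k * s\<^sup>2 - h * g * s" using k' by (simp add: power2_eq_square mult.commute mult.left_commute)
  have "(s *\<^sub>R x') \<bullet> (s *\<^sub>R x') = u \<bullet> u + h\<^sup>2 * s"
    unfolding ex using un nn by (simp add: inner_add_left inner_add_right power2_eq_square)
  then have uu: "u \<bullet> u = s * (s - h\<^sup>2)" using S' by (simp add: algebra_simps)
  have "(s *\<^sub>R y') \<bullet> (s *\<^sub>R y') = v \<bullet> v + g\<^sup>2 * s"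
    unfolding ex using un nn by (simp add: inner_add_left inner_add_right power2_eq_square)
  then have vv: "v \<bullet> v = s * (s - g\<^sup>2)" using S' by (simp add: algebra_simps)
  have "k * (norm u * norm v) \<le> u \<bullet> v"
    unfolding k_def using S nonneg
    by (intro extremal_pair_bound[OF C xy]) (auto simp: u_def v_def intro!: dual_cone_comb)
  also have "\<dots> \<le> k * s\<^sup>2"
    using mult_nonneg_nonneg[of "h * g" s] False s by (simp add: uv h_def g_def not_less)
  finally have "s\<^sup>2 \<le> norm u * norm v" using neg by (simp add: k_def mult_le_cancel_left)
  then have "(s\<^sup>2)\<^sup>2 \<le> (norm u * norm v)\<^sup>2" by (intro power_mono) auto
  also have "\<dots> = (u \<bullet> u) * (v \<bullet> v)" by (simp add: power_mult_distrib power2_norm_eq_inner)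
  also have "\<dots> = s\<^sup>2 * ((s - h\<^sup>2) * (s - g\<^sup>2))" unfolding uu vv by (simp add: power2_eq_square)
  finally have "s\<^sup>2 * s\<^sup>2 \<le> s\<^sup>2 * ((s - h\<^sup>2) * (s - g\<^sup>2))" by (simp add: power2_eq_square)
  then have le: "s * s \<le> (s - h\<^sup>2) * (s - g\<^sup>2)" using s by (simp add: power2_eq_square)
  have "0 \<le> s * (s - h\<^sup>2)" "0 \<le> s * (s - g\<^sup>2)" unfolding uu[symmetric] vv[symmetric] by auto
  then have hs: "0 \<le> s - h\<^sup>2" "0 \<le> s - g\<^sup>2" using s by (simp_all add: zero_le_mult_iff)
  have "(s - h\<^sup>2) * (s - g\<^sup>2) \<le> (s - h\<^sup>2) * s" "(s - h\<^sup>2) * (s - g\<^sup>2) \<le> s * (s - g\<^sup>2)"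
    using hs by (auto intro!: mult_left_mono mult_right_mono)
  then have "s * s \<le> (s - h\<^sup>2) * s" "s * s \<le> s * (s - g\<^sup>2)" using le by linarith+
  then have "h\<^sup>2 \<le> 0" "g\<^sup>2 \<le> 0" using s by (simp_all add: mult_le_cancel_left mult_le_cancel_right)
  then have hg: "h = 0" "g = 0" by simp_all
  have ex0: "s *\<^sub>R x' = a *\<^sub>R x + b *\<^sub>R y" "s *\<^sub>R y' = a' *\<^sub>R x + b' *\<^sub>R y" using ex hg by (simp_all add: u_def v_def)
  have "cross3 (s *\<^sub>R x') (s *\<^sub>R y') = (a * b' - b * a') *\<^sub>R n"
    unfolding ex0 n_def by (simp add: cross3_coordinates algebra_simps)
  then have "(s * s) *\<^sub>R cross3 x' y' = (a * b' - b * a') *\<^sub>R n"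
    by (simp add: cross_mult_left cross_mult_right)
  then have "((s * s) *\<^sub>R cross3 x' y') \<bullet> x = 0" "((s * s) *\<^sub>R cross3 x' y') \<bullet> y = 0" using nn by simp_all
  then have t0: "triple x' y' x = 0" "triple x' y' y = 0" using s by simp_all
  \<comment> \<open>All four vectors being in one plane, each pair spans a cone containing the other pair. So a nonnegative matrix has a nonnegative inverse up to scaling, and only a permutation of the rays is possible.\<close>
  define c where "c = center_vec y' x' \<bullet> x" define d where "d = center_vec x' y' \<bullet> x"
  define c' where "c' = center_vec y' x' \<bullet> y" define d' where "d' = center_vec x' y' \<bullet> y"
  have nonneg': "0 \<le> c" "0 \<le> d" "0 \<le> c'" "0 \<le> d'"
    unfolding c_def d_def c'_def d'_def
    using extremal_pair_facts(5)[OF C xy'] extremal_pair_facts(5)[OF C extremal_pair_commute[OF xy']] S by auto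
  have ex': "s *\<^sub>R x = c *\<^sub>R x' + d *\<^sub>R y'" "s *\<^sub>R y = c' *\<^sub>R x' + d' *\<^sub>R y'"
    using unit_frame_expansion[OF S'(1,2), of x] unit_frame_expansion[OF S'(1,2), of y]
    by (simp_all add: s_def k' c_def d_def c'_def d'_def t0)
  have "center_vec x y \<bullet> (s *\<^sub>R x) = 0" "center_vec y x \<bullet> (s *\<^sub>R y) = 0" using center_vec_orth S by simp_all
  then have "c * b + d * b' = 0" "c' * a + d' * a' = 0"
    unfolding ex' by (simp_all add: inner_add_right a_def b_def a'_def b'_def)
  then have z: "c * b = 0" "d * b' = 0" "c' * a = 0" "d' * a' = 0"
    using nonneg nonneg' by (simp_all add: add_nonneg_eq_0_iff)
  have ray: "p = q" if "p \<in> S2" "q \<in> S2" "s *\<^sub>R p = r *\<^sub>R q" "0 \<le> r" for p q r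
  proof -
    have "(1/s) *\<^sub>R (s *\<^sub>R p) = (1/s) *\<^sub>R (r *\<^sub>R q)" using that(3) by simp
    then have "p = (r/s) *\<^sub>R q" using s by simp
    then show ?thesis using S2_eq_if_same_ray[OF that(1,2), of "r/s"] that(4) s by simp
  qed
  have nzx: "s *\<^sub>R x' \<noteq> 0" "s *\<^sub>R y' \<noteq> 0" "s *\<^sub>R x \<noteq> 0" "s *\<^sub>R y \<noteq> 0" using s S S' by auto
  show ?thesis
  proof (cases "c = 0")
    case False
    then have "b = 0" using z by simp
    then have "x' = x" "a \<noteq> 0" using ray[OF S'(1) S(1), of a] ex0 nonneg nzx by auto
    then have "c' = 0" using z by simp
    then have "y = y'" using ray[OF S(2) S'(2), of d'] ex' nonneg' by simp
    then show ?thesis using \<open>x' = x\<close> by simp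
  next
    case True
    then have "d \<noteq> 0" using ex' nzx by auto
    then have "b' = 0" using z by simp
    then have "y' = x" "a' \<noteq> 0" using ray[OF S'(2) S(1), of a'] ex0 nonneg nzx by auto
    then have "d' = 0" using z by simp
    then have "y = x'" using ray[OF S(2) S'(1), of c'] ex' nonneg' by simp
    then show ?thesis using \<open>y' = x\<close> by simp
  qed
qed simp

lemma extremal_pair_unique:
  assumes C: "sph_convex_body C" and xy: "extremal_pair C x y" "extremal_pair C x y'" and neg: "x \<bullet> y < 0"
  shows "y' = y"
  using extremal_pairs_cross[OF C xy neg] extremal_pair_facts(1)[OF C xy(1)] by (auto simp: dot_cross_self)

text \<open>The vectors \<open>z\<close> and \<open>z'\<close> allow \<open>x\<close> to move by \<open>- t n\<close> and \<open>y\<close> by \<open>t n\<close>, where \<open>n\<close> is a multiple of \<open>x \<times> y\<close>: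
  this rotates both hemispheres in the same sense about the centers of their semicircles. With
  \<open>k = x \<bullet> y\<close> and \<open>r = t\<^sup>2 (n \<bullet> n)\<close> the inner product of the moved points is \<open>(k - r) / (1 + r)\<close>
  after normalization, which is less than \<open>k\<close>.\<close>

lemma extremal_pair_not_both_rotate:
  assumes C: "sph_convex_body C" and xy: "extremal_pair C x y"
    and z: "z \<in> dual_cone C" "z \<bullet> center_vec x y = 0"
    and z': "z' \<in> dual_cone C" "z' \<bullet> center_vec y x = 0"
    and opp: "triple x y z * triple x y z' < 0"
  shows False
proof -
  note S = extremal_pair_S2[OF C xy]
  define k where "k = x \<bullet> y"
  define s where "s = 1 - k\<^sup>2"
  define \<sigma> :: real where "\<sigma> = (if triple x y z < 0 then 1 else - 1)"
  have \<sigma>: "\<sigma> * \<sigma> = 1" by (simp add: \<sigma>_def)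
  define n where "n = \<sigma> *\<^sub>R cross3 x y"
  have s: "0 < s" using extremal_pair_square[OF C xy] by (simp add: s_def k_def)
  have nn: "n \<bullet> n = s" "n \<bullet> x = 0" "n \<bullet> y = 0" "x \<bullet> n = 0" "y \<bullet> n = 0"
    using cross_norm[of x y] S \<sigma> by (simp_all add: n_def s_def k_def dot_cross_self flip: mult.assoc)
  define A where "A = - (\<sigma> * triple x y z)" define A' where "A' = \<sigma> * triple x y z'"
  define B where "B = center_vec y x \<bullet> z" define B' where "B' = center_vec x y \<bullet> z'"
  have A: "0 < A" "0 < A'" using opp by (auto simp: A_def A'_def \<sigma>_def mult_less_0_iff)
  have \<sigma>t: "\<sigma> * t * \<sigma> = t" for t
  proof -
    have "\<sigma> * t * \<sigma> = (\<sigma> * \<sigma>) * t" by (simp only: ac_simps)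
    then show ?thesis using \<sigma> by simp
  qed
  have An: "A *\<^sub>R n = - (triple x y z *\<^sub>R cross3 x y)" "A' *\<^sub>R n = triple x y z' *\<^sub>R cross3 x y"
    by (simp_all add: A_def A'_def n_def \<sigma>t)
  have ez: "s *\<^sub>R z = B *\<^sub>R x - A *\<^sub>R n" "s *\<^sub>R z' = B' *\<^sub>R y + A' *\<^sub>R n"
    using unit_frame_expansion[OF S(1,2), of z] unit_frame_expansion[OF S(1,2), of z'] z(2) z'(2)
    by (simp_all add: An s_def k_def B_def B'_def inner_commute)
  \<comment> \<open>So small that x - t n and y + t n are still nonnegative combinations of z, x and of z', y.\<close>
  define t where "t = min (A / (\<bar>B\<bar> + 1)) (A' / (\<bar>B'\<bar> + 1))"
  have t: "0 < t" using A by (simp add: t_def)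
  have small: "t * b \<le> a" if "t \<le> a / (\<bar>b\<bar> + 1)" "0 < a" for a b :: real
  proof -
    have "t * (\<bar>b\<bar> + 1) \<le> a" using that by (simp add: le_divide_eq)
    moreover have "t * b \<le> t * (\<bar>b\<bar> + 1)" using t by (intro mult_left_mono) auto
    ultimately show ?thesis by linarith
  qed
  have tB: "t * B \<le> A" "t * B' \<le> A'"
    using small[of A B] small[of A' B'] A by (simp_all add: t_def)
  define X where "X = x - t *\<^sub>R n"
  define Y where "Y = y + t *\<^sub>R n"
  have "X = (t * s / A) *\<^sub>R z + (1 - t * B / A) *\<^sub>R x"
  proof -
    have "(t * s / A) *\<^sub>R z = (t / A) *\<^sub>R (s *\<^sub>R z)" by simp
    also have "\<dots> = (t * B / A) *\<^sub>R x - t *\<^sub>R n" unfolding ez using A by (simp add: scaleR_diff_right)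
    finally show ?thesis by (simp add: X_def scaleR_diff_left)
  qed
  moreover have "0 \<le> 1 - t * B / A" "0 \<le> t * s / A" using tB A t s by simp_all
  ultimately have X: "X \<in> dual_cone C" using dual_cone_comb[OF z(1) S(3)] by metis
  have "Y = (t * s / A') *\<^sub>R z' + (1 - t * B' / A') *\<^sub>R y"
  proof -
    have "(t * s / A') *\<^sub>R z' = (t / A') *\<^sub>R (s *\<^sub>R z')" by simp
    also have "\<dots> = (t * B' / A') *\<^sub>R y + t *\<^sub>R n" unfolding ez using A by (simp add: scaleR_add_right)
    finally show ?thesis by (simp add: Y_def scaleR_diff_left)
  qed
  moreover have "0 \<le> 1 - t * B' / A'" "0 \<le> t * s / A'" using tB A t s by simp_all
  ultimately have Y: "Y \<in> dual_cone C" using dual_cone_comb[OF z'(1) S(4)] by metis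
  define r where "r = t\<^sup>2 * s"
  have r: "0 < r" using t s by (simp add: r_def)
  have XY: "X \<bullet> Y = k - r" "X \<bullet> X = 1 + r" "Y \<bullet> Y = 1 + r"
    using nn S unfolding X_def Y_def r_def k_def
    by (simp_all add: inner_diff_left inner_diff_right inner_add_left inner_add_right power2_eq_square)
  have "norm X * norm Y = 1 + r" using XY r by (simp add: norm_eq_sqrt_inner)
  then have "k * (1 + r) \<le> k - r" using extremal_pair_bound[OF C xy X Y] XY by (simp add: k_def)
  then have "r * (k + 1) \<le> 0" by (simp add: algebra_simps)
  then have "k \<le> - 1" using r by (simp add: mult_le_0_iff)
  moreover have "- 1 < k" unfolding k_def using S2_inner_greater S extremal_pair_facts(2)[OF C xy] by blast
  ultimately show False by simp
qed

section \<open>Centers of thinnest lunes span a reduced body\<close>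

text \<open>Cutting by a half-space that keeps one interior point in its interior leaves a convex body.\<close>

lemma sph_convex_body_halfspace:
  assumes C: "sph_convex_body C" and p: "p \<in> top_of_set S2 interior_of C" "0 < g \<bullet> p"
  shows "sph_convex_body (C \<inter> {q. 0 \<le> g \<bullet> q})"
proof -
  let ?Z = "C \<inter> {q. 0 \<le> g \<bullet> q}"
  have conv: "sph_convex C" using body_facts[OF C] by blast
  have "sph_arc a b \<subseteq> ?Z" if ab: "a \<in> ?Z" "b \<in> ?Z" for a b
  proof
    fix z assume z: "z \<in> sph_arc a b"
    then obtain w where w: "w \<in> closed_segment a b" "z = w /\<^sub>R norm w" by (auto simp: sph_arc_def)
    have "closed_segment a b \<subseteq> {q. 0 \<le> g \<bullet> q}"
      using ab by (intro closed_segment_subset convex_halfspace_ge) auto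
    then have "0 \<le> g \<bullet> z" using w by auto
    moreover have "z \<in> C" using conv ab z unfolding sph_convex_def by blast
    ultimately show "z \<in> ?Z" by blast
  qed
  then have "sph_convex ?Z" using conv unfolding sph_convex_def by blast
  moreover have "closed ?Z" using body_facts(2)[OF C] by (intro closed_Int closed_halfspace_ge)
  moreover have "p \<in> top_of_set S2 interior_of ?Z"
  proof -
    have "openin (top_of_set S2) (S2 \<inter> {q. 0 < g \<bullet> q})" by (intro openin_open_Int open_halfspace_gt)
    then have o: "openin (top_of_set S2) ((top_of_set S2 interior_of C) \<inter> (S2 \<inter> {q. 0 < g \<bullet> q}))"
      by (rule openin_Int[OF openin_interior_of])
    have "p \<in> C" using subsetD[OF interior_of_subset p(1)] .
    then have "p \<in> S2" using body_facts(3)[OF C] by blast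
    then have "p \<in> (top_of_set S2 interior_of C) \<inter> (S2 \<inter> {q. 0 < g \<bullet> q})" using p by blast
    moreover have "(top_of_set S2 interior_of C) \<inter> (S2 \<inter> {q. 0 < g \<bullet> q}) \<subseteq> ?Z"
      using interior_of_subset[of "top_of_set S2" C] by auto
    ultimately show ?thesis using o unfolding interior_of_def by blast
  qed
  ultimately show ?thesis unfolding sph_convex_body_def by blast
qed

text \<open>In a smaller body the diametral distance of the polar set grows, so a diametral chord of the new
  polar set must have an endpoint outside the old one.\<close>

lemma reduced_cut:
  assumes R: "sph_reduced R" and K: "extremal_pair R x0 y0"
    and Z: "sph_convex_body Z" "Z \<subseteq> R" "Z \<noteq> R"
  obtains x y p where "extremal_pair Z x y" "x \<bullet> y < x0 \<bullet> y0" "p \<in> R" "x \<bullet> p < 0"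
proof -
  have C: "sph_convex_body R" using R by (simp add: sph_reduced_def)
  obtain x y where xy: "extremal_pair Z x y" using extremal_pair_exists[OF Z(1)] .
  have "thickness Z < thickness R" using R Z by (simp add: sph_reduced_def)
  then have "\<not> arccos (- (x0 \<bullet> y0)) \<le> arccos (- (x \<bullet> y))"
    using thickness_eq[OF C K] thickness_eq[OF Z(1) xy] by simp
  then have lt: "x \<bullet> y < x0 \<bullet> y0"
    using arccos_neg_inner_le[of x0 y0 x y] extremal_pair_S2[OF C K] extremal_pair_S2[OF Z(1) xy] by auto
  have "\<not> (x \<in> polar R \<and> y \<in> polar R)" using extremal_pairD(3)[OF K, of x y] lt by auto
  then have "\<not> (x \<in> dual_cone R \<and> y \<in> dual_cone R)"
    using body_polar_iff[OF C] extremal_pair_S2[OF Z(1) xy] by blast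
  then consider p where "p \<in> R" "x \<bullet> p < 0" | p where "p \<in> R" "y \<bullet> p < 0"
    unfolding dual_cone_def by force
  then show ?thesis
  proof cases
    case 1
    then show ?thesis using that[OF xy lt] by blast
  next
    case 2
    then show ?thesis using that[OF extremal_pair_commute[OF xy]] lt by (simp add: inner_commute)
  qed
qed

text \<open>The points of \<open>C\<close> with \<open>f > 0\<close> are dense in \<open>C\<close>: each point is the limit of combinations with \<open>p0\<close>.\<close>

lemma dual_cone_limit:
  assumes C: "sph_convex_body C" and p0: "p0 \<in> C"
    and pos: "\<And>q. q \<in> C \<Longrightarrow> 0 \<le> f \<bullet> q" "0 < f \<bullet> p0"
    and x: "\<And>q. q \<in> C \<Longrightarrow> 0 < f \<bullet> q \<Longrightarrow> 0 \<le> x \<bullet> q"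
  shows "x \<in> dual_cone C"
  unfolding dual_cone_iff
proof
  fix q assume q: "q \<in> C"
  have "0 \<le> x \<bullet> (q + e *\<^sub>R p0)" if "0 < e" for e
  proof -
    let ?w = "1 *\<^sub>R q + e *\<^sub>R p0"
    have w: "?w \<noteq> 0" "sgn ?w \<in> C"
      using sph_convex_combination[OF body_facts(1)[OF C] q p0, of 1 e] \<open>0 < e\<close> by auto
    have "0 < f \<bullet> ?w" using pos(1)[OF q] pos(2) \<open>0 < e\<close>
      by (simp add: inner_add_right add_nonneg_pos)
    then have "0 < f \<bullet> sgn ?w" using w(1) by (simp add: inner_commute[of f] sgn_inner)
    then have "0 \<le> x \<bullet> sgn ?w" using x w(2) by blast
    then show ?thesis using w(1) by (simp add: inner_commute[of x] sgn_inner zero_le_divide_iff)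
  qed
  then have "\<forall>\<^sub>F e in at_right 0. 0 \<le> x \<bullet> (q + e *\<^sub>R p0)"
    by (intro eventually_mono[OF eventually_at_right_less[of 0]]) auto
  moreover have "((\<lambda>e. x \<bullet> (q + e *\<^sub>R p0)) \<longlongrightarrow> x \<bullet> (q + 0 *\<^sub>R p0)) (at_right 0)"
    by (intro tendsto_intros)
  ultimately have "0 \<le> x \<bullet> (q + 0 *\<^sub>R p0)"
    using tendsto_lowerbound trivial_limit_at_right_real by blast
  then show "0 \<le> x \<bullet> q" by simp
qed

text \<open>If \<open>n\<close> were negative somewhere on \<open>R\<close>, the sum \<open>f\<close> of \<open>n\<close> and a suitable positive functional would be
  nonnegative on \<open>R\<close>, vanish on a face, and be positive at all centers of thinnest lunes. Cut off thin
  slices at this face. The remaining bodies have extremal pairs \<open>(x, y)\<close> such that \<open>x\<close> is negative at some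
  point \<open>p\<close> of the slice, and these pairs tend to an extremal pair of \<open>R\<close>. The center vector \<open>a\<close> of
  \<open>(x, y)\<close> keeps away from the face in the limit, so the point of \<open>R\<close> in direction \<open>a + p\<close> has not been cut
  off and \<open>x\<close> is nonnegative there. But \<open>x \<bullet> a = 0\<close> and \<open>x \<bullet> p < 0\<close>.\<close>

lemma centers_generate_reduced:
  assumes R: "sph_reduced R" and n: "\<And>x y. extremal_pair R x y \<Longrightarrow> 0 \<le> n \<bullet> center_vec x y"
  shows "n \<in> dual_cone R"
proof (rule ccontr)
  assume "n \<notin> dual_cone R"
  then obtain p' where p': "p' \<in> R" "n \<bullet> p' < 0" unfolding dual_cone_def by force
  have C: "sph_convex_body R" using R by (simp add: sph_reduced_def)
  note F = body_facts[OF C]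
  obtain c where c: "\<And>q. q \<in> R \<Longrightarrow> 0 < c \<bullet> q" using strictly_positive_functional[OF C] by blast
  have "continuous_on R (\<lambda>q. (n \<bullet> q) / (c \<bullet> q))"
    by (intro continuous_intros) (use c in force)
  then obtain q0 where q0: "q0 \<in> R" "\<forall>q\<in>R. (n \<bullet> q0) / (c \<bullet> q0) \<le> (n \<bullet> q) / (c \<bullet> q)"
    using continuous_attains_inf[OF F(5,4)] by blast
  define l where "l = - (n \<bullet> q0) / (c \<bullet> q0)"
  have "- l \<le> (n \<bullet> p') / (c \<bullet> p')" using bspec[OF q0(2) p'(1)] by (simp add: l_def)
  also have "\<dots> < 0" using p' c[OF p'(1)] by (simp add: divide_less_0_iff)
  finally have l: "0 < l" by simp
  \<comment> \<open>The least multiple of c that makes the functional nonnegative on R.\<close>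
  define f where "f = n + l *\<^sub>R c"
  have f: "0 \<le> f \<bullet> q" if "q \<in> R" for q
  proof -
    have "- l \<le> (n \<bullet> q) / (c \<bullet> q)" using bspec[OF q0(2) that] by (simp add: l_def)
    then have "- l * (c \<bullet> q) \<le> n \<bullet> q" using c[OF that] by (simp add: le_divide_eq)
    then show ?thesis by (simp add: f_def inner_add_left)
  qed
  have fq0: "f \<bullet> q0 = 0"
    using c[OF q0(1)] by (simp add: f_def l_def inner_add_left inner_diff_left)
  have fcen: "0 < f \<bullet> center_vec x y" if "extremal_pair R x y" for x y
  proof -
    have "0 < c \<bullet> sgn (center_vec x y)" using c extremal_pair_facts(3)[OF C that] by blast
    then have "0 < (c \<bullet> center_vec x y) / norm (center_vec x y)" by (simp add: inner_commute[of c] sgn_inner)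
    then have "0 < c \<bullet> center_vec x y" by (simp add: zero_less_divide_iff)
    then show ?thesis using n[OF that] l by (simp add: f_def inner_add_left add_nonneg_pos)
  qed
  obtain x0 y0 where K: "extremal_pair R x0 y0" using extremal_pair_exists[OF C] .
  have "f \<noteq> 0" using fcen[OF K] by auto
  have fd: "f \<in> dual_cone R" using f by (simp add: dual_cone_iff)
  obtain p0 where p0: "p0 \<in> R" "p0 \<in> top_of_set S2 interior_of R" "0 < f \<bullet> p0"
    using body_interior_point[OF C] fd \<open>f \<noteq> 0\<close> by metis
  define e where "e = (\<lambda>k. 1 / (real k + 1))"
  have e: "e \<longlonglongrightarrow> 0" unfolding e_def using LIMSEQ_inverse_real_of_nat by (simp add: inverse_eq_divide add.commute)
  have epos: "0 < e k" for k by (simp add: e_def)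
  define g where "g = (\<lambda>k. f - e k *\<^sub>R c)"
  \<comment> \<open>R without a thin slice at the face on which f vanishes.\<close>
  define Z where "Z = (\<lambda>k. R \<inter> {q. 0 \<le> g k \<bullet> q})"
  have gq: "(\<lambda>k. g k \<bullet> q) \<longlonglongrightarrow> f \<bullet> q" for q
  proof -
    have "(\<lambda>k. (f - e k *\<^sub>R c) \<bullet> q) \<longlonglongrightarrow> (f - 0 *\<^sub>R c) \<bullet> q" by (intro tendsto_intros e)
    then show ?thesis by (simp add: g_def)
  qed
  have "\<forall>\<^sub>F k in sequentially. 0 < g k \<bullet> p0" using order_tendstoD(1)[OF gq p0(3)] .
  then obtain k0 where k0: "\<And>k. k0 \<le> k \<Longrightarrow> 0 < g k \<bullet> p0" by (auto simp: eventually_sequentially)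
  have ZR: "Z k \<subseteq> R" "Z k \<noteq> R" for k
  proof -
    show "Z k \<subseteq> R" by (auto simp: Z_def)
    have "0 < e k * (c \<bullet> q0)" using epos c[OF q0(1)] by simp
    then have "g k \<bullet> q0 < 0" using fq0 by (simp add: g_def inner_diff_left)
    then have "q0 \<notin> Z k" by (simp add: Z_def)
    then show "Z k \<noteq> R" using q0(1) by blast
  qed
  have "\<exists>w. extremal_pair (Z (k + k0)) (fst w) (fst (snd w)) \<and> fst w \<bullet> fst (snd w) < x0 \<bullet> y0 \<and>
      snd (snd w) \<in> R \<and> fst w \<bullet> snd (snd w) < 0" for k
  proof -
    have "sph_convex_body (Z (k + k0))"
      unfolding Z_def by (rule sph_convex_body_halfspace[OF C p0(2)]) (simp add: k0)
    then obtain x y p where "extremal_pair (Z (k + k0)) x y" "x \<bullet> y < x0 \<bullet> y0" "p \<in> R" "x \<bullet> p < 0"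
      using reduced_cut[OF R K _ ZR] by metis
    then show ?thesis by (intro exI[of _ "(x, y, p)"]) simp
  qed
  then obtain W where W: "\<And>k. extremal_pair (Z (k + k0)) (fst (W k)) (fst (snd (W k)))"
    "\<And>k. fst (W k) \<bullet> fst (snd (W k)) < x0 \<bullet> y0"
    "\<And>k. snd (snd (W k)) \<in> R" "\<And>k. fst (W k) \<bullet> snd (snd (W k)) < 0" by metis
  have body: "sph_convex_body (Z (k + k0))" for k
    unfolding Z_def by (rule sph_convex_body_halfspace[OF C p0(2)]) (simp add: k0)
  have "W k \<in> S2 \<times> S2 \<times> R" for k
    using extremal_pair_S2(1,2)[OF body W(1)[of k]] W(3)[of k] by (metis mem_Times_iff)
  moreover have "seq_compact (S2 \<times> S2 \<times> R)"
    using F(5) by (intro compact_imp_seq_compact compact_Times) auto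
  ultimately obtain w r where w: "w \<in> S2 \<times> S2 \<times> R" "strict_mono r" "(W \<circ> r) \<longlonglongrightarrow> w"
    using seq_compactE[of "S2 \<times> S2 \<times> R" W] by metis
  define x where "x = fst w" define y where "y = fst (snd w)" define p where "p = snd (snd w)"
  define xs where "xs = (\<lambda>k. fst (W (r k)))"
  define ys where "ys = (\<lambda>k. fst (snd (W (r k))))"
  define ps where "ps = (\<lambda>k. snd (snd (W (r k))))"
  have lim: "xs \<longlonglongrightarrow> x" "ys \<longlonglongrightarrow> y" "ps \<longlonglongrightarrow> p"
    unfolding xs_def ys_def ps_def x_def y_def p_def
    using w(3) by (auto simp: o_def intro!: tendsto_fst tendsto_snd)
  have S: "x \<in> S2" "y \<in> S2" "p \<in> R" using w(1) by (auto simp: x_def y_def p_def)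
  define m where "m = (\<lambda>k. r k + k0)"
  have m: "filterlim m at_top sequentially"
    unfolding m_def by (rule filterlim_at_top_mono[OF filterlim_subseq[OF w(2)]]) simp
  have P: "extremal_pair (Z (m k)) (xs k) (ys k)" "xs k \<bullet> ys k < x0 \<bullet> y0" "ps k \<in> R" "xs k \<bullet> ps k < 0"
    "sph_convex_body (Z (m k))" for k
    using W[of "r k"] body[of "r k"] by (auto simp: xs_def ys_def ps_def m_def)
  note PS = extremal_pair_S2[OF P(5,1)]
  have em: "(\<lambda>k. e (m k)) \<longlonglongrightarrow> 0" using filterlim_compose[OF e m] .
  \<comment> \<open>The cut bodies exhaust the part of R where f is positive, so limits of their dual vectors are dual to R.\<close>
  have limdual: "v \<in> dual_cone R" if v: "vs \<longlonglongrightarrow> v" "\<And>k. vs k \<in> dual_cone (Z (m k))" for vs v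
  proof (rule dual_cone_limit[OF C p0(1) f p0(3)])
    fix q assume q: "q \<in> R" "0 < f \<bullet> q"
    have "\<forall>\<^sub>F k in sequentially. 0 < g (m k) \<bullet> q"
      using order_tendstoD(1)[OF filterlim_compose[OF gq m] q(2)] .
    then have "\<forall>\<^sub>F k in sequentially. 0 \<le> vs k \<bullet> q"
    proof eventually_elim
      case (elim k)
      then have "q \<in> Z (m k)" using q(1) by (simp add: Z_def)
      then show ?case using dual_coneD[OF v(2)] by blast
    qed
    moreover have "(\<lambda>k. vs k \<bullet> q) \<longlonglongrightarrow> v \<bullet> q" by (intro tendsto_intros v(1))
    ultimately show "0 \<le> v \<bullet> q" using tendsto_lowerbound trivial_limit_sequentially by blast
  qed
  have "x \<in> polar R" "y \<in> polar R"
    using limdual[OF lim(1) PS(3)] limdual[OF lim(2) PS(4)] S body_polar_iff[OF C] by auto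
  moreover have "x \<bullet> y \<le> x0 \<bullet> y0"
  proof (rule tendsto_upperbound[OF tendsto_inner[OF lim(1,2)]])
    show "\<forall>\<^sub>F k in sequentially. xs k \<bullet> ys k \<le> x0 \<bullet> y0" using P(2) by (simp add: less_imp_le)
  qed simp
  ultimately have X: "extremal_pair R x y"
    using extremal_pairD(3)[OF K] unfolding extremal_pair_def by (meson order_trans)
  define h where "h = (\<lambda>k. center_vec (xs k) (ys k) + ps k)"
  have h: "h \<longlonglongrightarrow> center_vec x y + p" unfolding h_def center_vec_def by (intro tendsto_intros lim)
  have "(\<lambda>k. (f - e (m k) *\<^sub>R c) \<bullet> h k) \<longlonglongrightarrow> (f - 0 *\<^sub>R c) \<bullet> (center_vec x y + p)"
    by (intro tendsto_intros em h)
  then have gh: "(\<lambda>k. g (m k) \<bullet> h k) \<longlonglongrightarrow> f \<bullet> (center_vec x y + p)" by (simp add: g_def)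
  have "0 < f \<bullet> (center_vec x y + p)" using fcen[OF X] f[OF S(3)] by (simp add: inner_add_right)
  then have "\<forall>\<^sub>F k in sequentially. 0 < g (m k) \<bullet> h k" using order_tendstoD(1)[OF gh] by blast
  then obtain k where k: "0 < g (m k) \<bullet> h k" using eventually_happens trivial_limit_sequentially by blast
  have aZ: "sgn (center_vec (xs k) (ys k)) \<in> R" using extremal_pair_facts(3)[OF P(5,1)] ZR(1) by blast
  have hk: "h k = norm (center_vec (xs k) (ys k)) *\<^sub>R sgn (center_vec (xs k) (ys k)) + 1 *\<^sub>R ps k"
    by (simp add: h_def norm_scaleR_sgn)
  have nz: "h k \<noteq> 0" "sgn (h k) \<in> R"
    unfolding hk by (intro sph_convex_combination[OF F(1) aZ P(3)] norm_ge_zero zero_le_one add_nonneg_pos zero_less_one)+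
  have "0 < g (m k) \<bullet> sgn (h k)" using k nz(1) by (simp add: inner_commute[of "g (m k)"] sgn_inner)
  then have "sgn (h k) \<in> Z (m k)" using nz(2) by (simp add: Z_def)
  then have "0 \<le> xs k \<bullet> sgn (h k)" using dual_coneD[OF PS(3)] by blast
  then have "0 \<le> xs k \<bullet> h k" using nz(1) by (simp add: inner_commute[of "xs k"] sgn_inner zero_le_divide_iff)
  moreover have "xs k \<bullet> h k = xs k \<bullet> ps k"
    using center_vec_orth[OF PS(1), of k "ys k"] by (simp add: h_def inner_add_right inner_commute[of "xs k" "center_vec (xs k) (ys k)"])
  ultimately show False using P(4)[of k] by simp
qed

section \<open>Two neighbouring thinnest lunes\<close>

text \<open>For points of the boundary of a polar set that contains points to the left of the chord from \<open>p\<close> to \<open>q\<close>: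
  \<open>x\<close> comes after \<open>p\<close> and before \<open>q\<close> in the positive orientation. The second alternative covers a
  chord that is itself part of the boundary.\<close>

definition lies_between :: "real^3 \<Rightarrow> real^3 \<Rightarrow> real^3 \<Rightarrow> bool" where
  "lies_between p x q \<longleftrightarrow> 0 < triple p x q \<or> (\<exists>\<alpha>>0. \<exists>\<beta>>0. x = \<alpha> *\<^sub>R p + \<beta> *\<^sub>R q)"

lemma triple_perms: 
  "triple x z y = - triple x y z" "triple y x z = - triple x y z" "triple y z x = triple x y z"
  "triple z x y = triple x y z" "triple z y x = - triple x y z"
  by (simp_all add: cross3_coordinates algebra_simps)

lemma triple_same: "triple x x y = 0" "triple x y x = 0" "triple y x x = 0"
  by (simp_all add: dot_cross_self)

lemma eq_zero_if_orthogonal_basis: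
  assumes "triple a e b \<noteq> 0" "a \<bullet> r = 0" "e \<bullet> r = 0" "b \<bullet> r = 0" shows "r = 0"
  using dual_basis_expansion[of a e b r] assms by (simp add: inner_commute)

lemma same_ray_scaled:
  assumes "p \<in> S2" "q \<in> S2" "T \<noteq> 0" "T *\<^sub>R p = b *\<^sub>R v" "T *\<^sub>R q = d *\<^sub>R v" "0 \<le> b" "0 \<le> d"
  shows "p = q"
proof -
  have "d \<noteq> 0" using assms by auto
  have "T *\<^sub>R (d *\<^sub>R p - b *\<^sub>R q) = d *\<^sub>R (T *\<^sub>R p) - b *\<^sub>R (T *\<^sub>R q)"
    by (simp add: scaleR_diff_right mult.commute)
  also have "\<dots> = 0" unfolding assms(4,5) by (simp add: mult.commute)
  finally have "d *\<^sub>R p = b *\<^sub>R q" using \<open>T \<noteq> 0\<close> by (metis eq_iff_diff_eq_0 scaleR_eq_0_iff)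
  then have "(1/d) *\<^sub>R (d *\<^sub>R p) = (1/d) *\<^sub>R (b *\<^sub>R q)" by simp
  then have "p = (b/d) *\<^sub>R q" using \<open>d \<noteq> 0\<close> by simp
  then show ?thesis using S2_eq_if_same_ray[OF assms(1,2), of "b/d"] assms(6,7) by simp
qed

text \<open>Let \<open>a\<close>, \<open>b\<close>, \<open>e\<close> be the three center vectors and suppose that \<open>e\<close> is strictly beyond the great
  circle through \<open>a\<close> and \<open>b\<close>. In coordinates dual to the basis \<open>a\<close>, \<open>e\<close>, \<open>b\<close> all points of the polar set are
  nonnegative and \<open>p\<close>, \<open>x\<close>, \<open>q\<close> each have a vanishing coordinate, at \<open>a\<close>, \<open>e\<close>, \<open>b\<close> respectively. Such a
  determinant is nonnegative, so \<open>x\<close> is between \<open>p\<close> and \<open>q\<close> unless it vanishes. Then two of \<open>p\<close>, \<open>x\<close>, \<open>q\<close>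
  coincide, or \<open>x\<close> lies in the segment from \<open>p\<close> to \<open>q\<close>, or \<open>p\<close> or \<open>q\<close> lies on an edge in a way that
  contradicts the position of \<open>p'\<close> or \<open>q'\<close>.\<close>

lemma centers_supported:
  assumes C: "sph_convex_body C" and neg: "p \<bullet> p' < 0"
    and P: "extremal_pair C p p'" and Q: "extremal_pair C q q'"
    and or: "0 < triple p q p'" "0 < triple p q q'"
    and none: "\<forall>x y. extremal_pair C x y \<longrightarrow> \<not> lies_between p x q"
    and X: "extremal_pair C x y"
  shows "0 \<le> triple (center_vec p p') (center_vec q q') (center_vec x y)"
proof (rule ccontr)
  assume "\<not> 0 \<le> triple (center_vec p p') (center_vec q q') (center_vec x y)"
  define a where "a = center_vec p p'" define b where "b = center_vec q q'" define e where "e = center_vec x y"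
  define T where "T = triple a e b"
  have T: "0 < T"
    using \<open>\<not> 0 \<le> triple (center_vec p p') (center_vec q q') (center_vec x y)\<close> triple_perms(1)[of a b e]
    by (simp add: T_def a_def b_def e_def)
  note SP = extremal_pair_S2[OF C P] note SQ = extremal_pair_S2[OF C Q] note SX = extremal_pair_S2[OF C X]
  have nonneg: "0 \<le> z \<bullet> a" "0 \<le> z \<bullet> b" "0 \<le> z \<bullet> e" if "z \<in> dual_cone C" for z
    unfolding a_def b_def e_def
    using extremal_pair_facts(5)[OF C P that] extremal_pair_facts(5)[OF C Q that] extremal_pair_facts(5)[OF C X that]
    by (simp_all add: inner_commute[of z])
  have orth: "p \<bullet> a = 0" "q \<bullet> b = 0" "x \<bullet> e = 0"
    using center_vec_orth[OF SP(1), of p'] center_vec_orth[OF SQ(1), of q'] center_vec_orth[OF SX(1), of y]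
    by (simp_all add: a_def b_def e_def inner_commute)
  define A where "A = cross3 e b" define B where "B = cross3 b a" define D where "D = cross3 a e"
  have ex: "T *\<^sub>R z = (z \<bullet> a) *\<^sub>R A + (z \<bullet> e) *\<^sub>R B + (z \<bullet> b) *\<^sub>R D" for z
    unfolding T_def A_def B_def D_def by (rule dual_basis_expansion)
  note n = nonneg[OF SP(3)] nonneg[OF SQ(3)] nonneg[OF SX(3)]
  have nbx: "\<not> lies_between p x q" using none X by blast
  have px: "x \<noteq> p"
  proof
    assume "x = p"
    then have "y = p'" using extremal_pair_unique[OF C P] X neg by blast
    then show False using T \<open>x = p\<close> by (simp add: T_def a_def e_def triple_same)
  qed
  have qx: "x \<noteq> q"
  proof
    assume "x = q"
    then have "y = q'" using extremal_pair_unique[OF C Q] X neg extremal_pair_same_inner[OF P Q] by metis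
    then show False using T \<open>x = q\<close> by (simp add: T_def b_def e_def triple_same)
  qed
  have pq: "p \<noteq> q" using or by (auto simp: triple_same)
  have "triple p x q * T = (p \<bullet> e) * ((x \<bullet> b) * (q \<bullet> a)) + (p \<bullet> b) * ((x \<bullet> a) * (q \<bullet> e))"
    unfolding T_def gram_triple orth by simp
  moreover have "triple p x q * T \<le> 0"
    using nbx T by (simp add: lies_between_def mult_le_0_iff not_less)
  moreover have "0 \<le> (p \<bullet> e) * ((x \<bullet> b) * (q \<bullet> a))" "0 \<le> (p \<bullet> b) * ((x \<bullet> a) * (q \<bullet> e))" using n by auto
  ultimately have "(p \<bullet> e) * ((x \<bullet> b) * (q \<bullet> a)) = 0" "(p \<bullet> b) * ((x \<bullet> a) * (q \<bullet> e)) = 0" by linarith+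
  then have z: "p \<bullet> e = 0 \<or> x \<bullet> b = 0 \<or> q \<bullet> a = 0" "p \<bullet> b = 0 \<or> x \<bullet> a = 0 \<or> q \<bullet> e = 0" by auto
  have gP: "triple p q p' * T = (p \<bullet> b) * ((q \<bullet> a) * (p' \<bullet> e) - (q \<bullet> e) * (p' \<bullet> a))
      - (p \<bullet> e) * ((q \<bullet> a) * (p' \<bullet> b))"
    unfolding T_def gram_triple orth by simp
  have gQ: "triple p q q' * T = (p \<bullet> b) * ((q \<bullet> a) * (q' \<bullet> e) - (q \<bullet> e) * (q' \<bullet> a))
      - (p \<bullet> e) * ((q \<bullet> a) * (q' \<bullet> b))"
    unfolding T_def gram_triple orth by simp
  have n': "0 \<le> p' \<bullet> a" "0 \<le> q' \<bullet> b" using nonneg[OF SP(4)] nonneg[OF SQ(4)] by auto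
  have Tne: "T \<noteq> 0" using T by simp
  \<comment> \<open>In case 1 the point x coincides with p or q or lies on the segment between them; cases 2 and 3 also use the positions of q' and p'.\<close>
  consider (1) "p \<bullet> e = 0" | (2) "p \<bullet> e \<noteq> 0" "x \<bullet> b = 0" | (3) "p \<bullet> e \<noteq> 0" "x \<bullet> b \<noteq> 0" "q \<bullet> a = 0"
    using z(1) by blast
  then show False
  proof cases
    case 1
    have p: "T *\<^sub>R p = (p \<bullet> b) *\<^sub>R D" using ex[of p] orth 1 by simp
    have "p \<bullet> b \<noteq> 0" using p Tne SP(1) by auto
    then consider "x \<bullet> a = 0" | "x \<bullet> b = 0" "q \<bullet> e = 0" | "x \<bullet> a \<noteq> 0" "x \<bullet> b \<noteq> 0" "q \<bullet> e = 0" using z(2) by blast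
    then show False
    proof cases
      assume "x \<bullet> a = 0"
      then have "T *\<^sub>R x = (x \<bullet> b) *\<^sub>R D" using ex[of x] orth by simp
      then show False using same_ray_scaled[OF SX(1) SP(1) Tne _ p] n px by blast
    next
      assume *: "x \<bullet> b = 0" "q \<bullet> e = 0"
      then have "T *\<^sub>R x = (x \<bullet> a) *\<^sub>R A" "T *\<^sub>R q = (q \<bullet> a) *\<^sub>R A" using ex[of x] ex[of q] orth by simp_all
      then show False using same_ray_scaled[OF SX(1) SQ(1) Tne] n qx by blast
    next
      assume *: "x \<bullet> a \<noteq> 0" "x \<bullet> b \<noteq> 0" "q \<bullet> e = 0"
      then have q: "T *\<^sub>R q = (q \<bullet> a) *\<^sub>R A" using ex[of q] orth by simp
      have qa: "q \<bullet> a \<noteq> 0" using q Tne SQ(1) by auto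
      have "T *\<^sub>R x = (x \<bullet> a) *\<^sub>R A + (x \<bullet> b) *\<^sub>R D" using ex[of x] orth by simp
      also have "A = (T / (q \<bullet> a)) *\<^sub>R q"
        using arg_cong[OF q, of "\<lambda>w. (1 / (q \<bullet> a)) *\<^sub>R w"] qa by simp
      also have "D = (T / (p \<bullet> b)) *\<^sub>R p"
        using arg_cong[OF p, of "\<lambda>w. (1 / (p \<bullet> b)) *\<^sub>R w"] \<open>p \<bullet> b \<noteq> 0\<close> by simp
      finally have "T *\<^sub>R x = T *\<^sub>R (((x \<bullet> b) / (p \<bullet> b)) *\<^sub>R p + ((x \<bullet> a) / (q \<bullet> a)) *\<^sub>R q)"
        by (simp add: scaleR_add_right mult.commute)
      then have "x = ((x \<bullet> b) / (p \<bullet> b)) *\<^sub>R p + ((x \<bullet> a) / (q \<bullet> a)) *\<^sub>R q" using Tne by simp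
      moreover have "0 < (x \<bullet> b) / (p \<bullet> b)" "0 < (x \<bullet> a) / (q \<bullet> a)"
        using n * qa \<open>p \<bullet> b \<noteq> 0\<close> by simp_all
      ultimately have "lies_between p x q" unfolding lies_between_def by blast
      then show False using nbx by blast
    qed
  next
    case 2
    then have x: "T *\<^sub>R x = (x \<bullet> a) *\<^sub>R A" using ex[of x] orth by simp
    then have xa: "x \<bullet> a \<noteq> 0" using Tne SX(1) by auto
    show False
    proof (cases "p \<bullet> b = 0")
      case True
      then have "triple p q q' * T \<le> 0" unfolding gQ using n n' by simp
      then show False using or(2) T by (simp add: mult_le_0_iff)
    next
      case False
      then have "T *\<^sub>R q = (q \<bullet> a) *\<^sub>R A" using ex[of q] orth xa z(2) by simp
      then show False using same_ray_scaled[OF SX(1) SQ(1) Tne x] n qx by blast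
    qed
  next
    case 3
    then have q: "T *\<^sub>R q = (q \<bullet> e) *\<^sub>R B" using ex[of q] orth by simp
    then have qe: "q \<bullet> e \<noteq> 0" using Tne SQ(1) by auto
    show False
    proof (cases "p \<bullet> b = 0")
      case True
      then have "T *\<^sub>R p = (p \<bullet> e) *\<^sub>R B" using ex[of p] orth by simp
      then show False using same_ray_scaled[OF SP(1) SQ(1) Tne _ q] n pq by blast
    next
      case False
      have "0 \<le> (p \<bullet> b) * ((q \<bullet> e) * (p' \<bullet> a))" using n n' by simp
      then have "triple p q p' * T \<le> 0" unfolding gP using 3 by simp
      then show False using or(1) T by (simp add: mult_le_0_iff)
    qed
  qed
qed

text \<open>A supporting hemisphere touching at \<open>w\<close> is nonnegative at \<open>a\<close>, \<open>b\<close>, \<open>c\<close>; as a multiple of \<open>w\<close>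
  is a positive combination of them, all three lie on its bounding great circle. But this circle cannot
  contain the independent points \<open>w\<close>, \<open>b\<close>, \<open>c\<close>.\<close>

lemma boundary_point_not_surrounded:
  assumes C: "sph_convex_body C" and w: "w \<in> sph_bd (polar C)"
    and abc: "a \<in> dual_cone C" "b \<in> dual_cone C" "c \<in> dual_cone C" "triple w b c \<noteq> 0"
    and comb: "l *\<^sub>R w = s *\<^sub>R a + t *\<^sub>R b + r *\<^sub>R c" "0 < s" "0 < t" "0 < r"
  shows False
proof -
  obtain p where p: "p \<in> C" "w \<bullet> p = 0" using w sph_bd_polar[OF body_facts(5,3,4)[OF C]] by blast
  have "l * (w \<bullet> p) = s * (a \<bullet> p) + t * (b \<bullet> p) + r * (c \<bullet> p)"
    using arg_cong[OF comb(1), of "\<lambda>v. v \<bullet> p"] by (simp add: inner_add_left)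
  then have "s * (a \<bullet> p) + t * (b \<bullet> p) + r * (c \<bullet> p) = 0" using p(2) by simp
  moreover have "0 \<le> s * (a \<bullet> p)" "0 \<le> t * (b \<bullet> p)" "0 \<le> r * (c \<bullet> p)"
    using abc comb dual_coneD[OF _ p(1)] by simp_all
  ultimately have "t * (b \<bullet> p) = 0" "r * (c \<bullet> p) = 0" by linarith+
  then have "b \<bullet> p = 0" "c \<bullet> p = 0" using comb by simp_all
  then have "p = 0" using eq_zero_if_orthogonal_basis[OF abc(4) p(2)] by blast
  moreover have "p \<in> S2" using p(1) body_facts(3)[OF C] by blast
  ultimately show False by simp
qed

text \<open>The chord from \<open>x\<close>, which starts between \<open>p'\<close> and \<open>q'\<close>, must cross both the chord \<open>pp'\<close> and the chord \<open>qq'\<close>,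
  so it ends in the sector of \<open>p\<close> and \<open>q\<close> seen from the intersection of these two chords. As a boundary
  point, its endpoint \<open>y\<close> is not inside the triangle spanned by \<open>p\<close>, \<open>q\<close> and that intersection.\<close>

lemma partner_between:
  assumes C: "sph_convex_body C" and neg: "p \<bullet> p' < 0"
    and P: "extremal_pair C p p'" and Q: "extremal_pair C q q'"
    and or: "0 < triple p q p'" "0 < triple p q q'" "0 < triple p p' q'" "0 < triple q p' q'"
    and X: "extremal_pair C x y" and bt: "lies_between p' x q'"
  shows "lies_between p y q"
proof -
  note SP = extremal_pair_S2[OF C P] note SQ = extremal_pair_S2[OF C Q] note SX = extremal_pair_S2[OF C X]
  note bdP = extremal_pair_facts(4)[OF C extremal_pair_commute[OF P]]
  note bdQ = extremal_pair_facts(4)[OF C extremal_pair_commute[OF Q]]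
  have negQ: "q \<bullet> q' < 0" using neg extremal_pair_same_inner[OF P Q] by simp
  have ne: "x \<noteq> p" "x \<noteq> p'" "x \<noteq> q" "x \<noteq> q'" if "0 < triple p' x q'"
    using that or triple_perms(2)[of p p' q'] triple_perms(2)[of q p' q'] by (auto simp: triple_same)
  have s1: "0 < triple p p' x"
    using bt unfolding lies_between_def
  proof
    assume t: "0 < triple p' x q'"
    have "triple p p' x \<noteq> 0" using extremal_pairs_cross[OF C P X neg] ne[OF t] by auto
    moreover have "\<not> triple p p' x < 0"
    proof
      assume n: "triple p p' x < 0"
      have "triple p x q' *\<^sub>R p' = triple p' x q' *\<^sub>R p + triple p p' q' *\<^sub>R x + (- triple p p' x) *\<^sub>R q'"
        using four_vector_relation[of p' x q' p] by (simp add: algebra_simps)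
      from boundary_point_not_surrounded[OF C bdP SP(3) SX(3) SQ(4) _ this] show False
        using t n or by simp
    qed
    ultimately show ?thesis by linarith
  next
    assume "\<exists>\<alpha>>0. \<exists>\<beta>>0. x = \<alpha> *\<^sub>R p' + \<beta> *\<^sub>R q'"
    then obtain \<alpha> \<beta> where "0 < \<alpha>" "0 < \<beta>" "x = \<alpha> *\<^sub>R p' + \<beta> *\<^sub>R q'" by blast
    then show ?thesis using or(3) by (simp add: inner_add_right triple_same)
  qed
  have s2: "triple q q' x < 0"
    using bt unfolding lies_between_def
  proof
    assume t: "0 < triple p' x q'"
    have "triple q q' x \<noteq> 0" using extremal_pairs_cross[OF C Q X negQ] ne[OF t] by auto
    moreover have "\<not> 0 < triple q q' x"
    proof
      assume n: "0 < triple q q' x"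
      have "(- triple q x p') *\<^sub>R q' = triple p' x q' *\<^sub>R q + triple q p' q' *\<^sub>R x + triple q q' x *\<^sub>R p'"
        using four_vector_relation[of q' x p' q] triple_perms(5)[of q' x p'] triple_perms(1)[of q p' q']
        by (simp add: algebra_simps)
      from boundary_point_not_surrounded[OF C bdQ SQ(3) SX(3) SP(4) _ this] show False
        using t n or triple_perms(5)[of q' x p'] by simp
    qed
    ultimately show ?thesis by linarith
  next
    assume "\<exists>\<alpha>>0. \<exists>\<beta>>0. x = \<alpha> *\<^sub>R p' + \<beta> *\<^sub>R q'"
    then obtain \<alpha> \<beta> where "0 < \<alpha>" "0 < \<beta>" "x = \<alpha> *\<^sub>R p' + \<beta> *\<^sub>R q'" by blast
    then show ?thesis using or(4) triple_perms(1)[of q p' q']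
      by (simp add: inner_add_right triple_same mult_pos_neg)
  qed
  have cP: "triple p p' y < 0"
    using extremal_pairs_cross[OF C P X neg] s1 by (auto simp: triple_same mult_less_0_iff)
  have cQ: "0 < triple q q' y"
    using extremal_pairs_cross[OF C Q X negQ] s2 by (auto simp: triple_same mult_less_0_iff)
  \<comment> \<open>The intersection of the chords from p to p' and from q to q'.\<close>
  define I where "I = triple q p' q' *\<^sub>R p + triple p q q' *\<^sub>R p'"
  have I: "I = triple p p' q' *\<^sub>R q + triple p q p' *\<^sub>R q'"
    using four_vector_relation[of q p' q' p] by (simp add: I_def algebra_simps)
  have pqI: "0 < triple p q I" using or by (simp add: I_def inner_add_right triple_same)
  have "triple q I y = triple p q p' * triple q q' y"
    unfolding I by (simp add: cross_add_right cross_mult_right inner_add_left triple_same)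
  then have qIy: "0 < triple q I y" using or cQ by simp
  have "triple I p y = - triple p q q' * triple p p' y"
    unfolding I_def by (simp add: cross_add_left cross_mult_left inner_add_left triple_same triple_perms(2)[of p' p])
  then have Ipy: "0 < triple I p y" using or cP by (simp add: mult_less_0_iff)
  \<comment> \<open>Coordinates of y with respect to p, q, I: the first two are positive, and the sign of the third tells on which side of the segment from p to q the point y lies.\<close>
  have ey: "triple p q I *\<^sub>R y = triple q I y *\<^sub>R p + triple I p y *\<^sub>R q + triple p q y *\<^sub>R I"
    using four_vector_relation[of q I y p] triple_perms(2)[of p I y] by (simp add: algebra_simps)
  have I_dual: "I \<in> dual_cone C" unfolding I_def
    using dual_cone_comb[OF SP(3,4)] or by simp
  consider "triple p q y < 0" | "triple p q y = 0" | "0 < triple p q y" by linarith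
  then show ?thesis
  proof cases
    assume "triple p q y < 0"
    then show ?thesis using triple_perms(1)[of p y q] by (simp add: lies_between_def)
  next
    assume "triple p q y = 0"
    then have e: "triple p q I *\<^sub>R y = triple q I y *\<^sub>R p + triple I p y *\<^sub>R q" using ey by simp
    have "y = (triple q I y / triple p q I) *\<^sub>R p + (triple I p y / triple p q I) *\<^sub>R q"
      using arg_cong[OF e, of "\<lambda>v. (1 / triple p q I) *\<^sub>R v"] pqI by (simp add: scaleR_add_right)
    moreover have "0 < triple q I y / triple p q I" "0 < triple I p y / triple p q I" using pqI qIy Ipy by simp_all
    ultimately show ?thesis unfolding lies_between_def by blast
  next
    assume pos: "0 < triple p q y"
    have "y \<in> sph_bd (polar C)" using extremal_pair_facts(4)[OF C extremal_pair_commute[OF X]] .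
    then show ?thesis
      using boundary_point_not_surrounded[OF C _ SP(3) SQ(3) I_dual _ ey qIy Ipy pos]
        qIy triple_perms(4)[of y q I] by simp
  qed
qed

text \<open>At the chord \<open>pp'\<close>, the hemisphere \<open>H(p)\<close> can be rotated about the center of its semicircle towards the other lune unless
  its boundary contains \<open>a2\<close> while \<open>a1\<close> is not on the boundary of \<open>H(q)\<close>: otherwise \<open>a1 \<times> a2\<close> or
  \<open>q\<close> itself provides the rotation. The same holds for \<open>H(p')\<close> with \<open>b1\<close>, \<open>b2\<close>, \<open>q'\<close>, and for the
  chord \<open>qq'\<close>. Not both hemispheres of a lune can be rotated, and combining the conditions at the two
  chords leaves two mirror cases, each of which yields \<open>p \<bullet> q = p' \<bullet> q'\<close>.\<close>

lemma centers_equidistant: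
  assumes C: "sph_convex_body C" and neg: "p \<bullet> p' < 0"
    and P: "extremal_pair C p p'" and Q: "extremal_pair C q q'"
    and or: "0 < triple p q p'" "0 < triple p q q'" "0 < triple p p' q'" "0 < triple q p' q'"
    and sup: "cross3 (center_vec p p') (center_vec q q') \<in> dual_cone C" "cross3 (center_vec p' p) (center_vec q' q) \<in> dual_cone C"
  shows "center_vec p p' \<bullet> center_vec q q' = center_vec p' p \<bullet> center_vec q' q"
proof -
  note P' = extremal_pair_commute[OF P] and Q' = extremal_pair_commute[OF Q]
  note SP = extremal_pair_S2[OF C P] note SQ = extremal_pair_S2[OF C Q]
  define k where "k = p \<bullet> p'"
  have k: "p \<bullet> p' = k" "q \<bullet> q' = k" "p' \<bullet> p = k" "q' \<bullet> q = k"
    using extremal_pair_same_inner[OF P Q] by (simp_all add: k_def inner_commute)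
  define a1 where "a1 = center_vec p p'" define a2 where "a2 = center_vec q q'"
  define b1 where "b1 = center_vec p' p" define b2 where "b2 = center_vec q' q"
  define s where "s = 1 - k\<^sup>2"
  have s: "0 < s" using extremal_pair_square[OF C P] by (simp add: s_def k)
  have own: "a1 \<bullet> p = 0" "a1 \<bullet> p' = s" "b1 \<bullet> p = s" "b1 \<bullet> p' = 0" "a2 \<bullet> q = 0" "a2 \<bullet> q' = s" "b2 \<bullet> q = s" "b2 \<bullet> q' = 0"
    using center_vec_orth center_vec_inner_other SP SQ k by (simp_all add: a1_def a2_def b1_def b2_def s_def)
  have nonneg: "0 \<le> a1 \<bullet> q" "0 \<le> a2 \<bullet> p" "0 \<le> b1 \<bullet> q'" "0 \<le> b2 \<bullet> p'"
    unfolding a1_def a2_def b1_def b2_def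
    using extremal_pair_facts(5)[OF C P SQ(3)] extremal_pair_facts(5)[OF C Q SP(3)]
      extremal_pair_facts(5)[OF C P' SQ(4)] extremal_pair_facts(5)[OF C Q' SP(4)] by auto
  have lag: "cross3 u v \<bullet> cross3 w z = (u \<bullet> w) * (v \<bullet> z) - (u \<bullet> z) * (v \<bullet> w)" for u v w z :: "real^3"
    by (simp add: cross3_coordinates algebra_simps)
  have orth: "cross3 u v \<bullet> u = 0" "cross3 u v \<bullet> v = 0" for u v :: "real^3" by (simp_all add: dot_cross_self)
  have tA: "triple p p' (cross3 a1 a2) = - s * (a2 \<bullet> p)" "triple q q' (cross3 a1 a2) = s * (a1 \<bullet> q)"
    "triple p p' (cross3 b1 b2) = s * (b2 \<bullet> p')" "triple q q' (cross3 b1 b2) = - s * (b1 \<bullet> q')"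
    unfolding lag using own by (simp_all add: inner_commute)
  have tq: "triple p p' q < 0" "0 < triple p p' q'" "0 < triple q q' p" "triple q q' p' < 0"
    using or triple_perms[of p q p'] triple_perms[of p q q'] triple_perms[of q p' q'] by simp_all
  have rP: "(a2 \<bullet> p = 0 \<and> a1 \<bullet> q \<noteq> 0) \<or> (b2 \<bullet> p' = 0 \<and> b1 \<bullet> q' \<noteq> 0)"
  proof (rule ccontr)
    assume c: "\<not> ?thesis"
    have "\<exists>z\<in>dual_cone C. z \<bullet> a1 = 0 \<and> triple p p' z < 0"
    proof (cases "a2 \<bullet> p = 0")
      case True
      then show ?thesis using c SQ(3) tq(1) by (metis inner_commute)
    next
      case False
      then have "triple p p' (cross3 a1 a2) < 0" using nonneg s by (simp add: tA mult_less_0_iff)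
      then show ?thesis using sup(1) orth(1)[of a1 a2] by (auto simp: a1_def a2_def)
    qed
    moreover have "\<exists>z\<in>dual_cone C. z \<bullet> b1 = 0 \<and> 0 < triple p p' z"
    proof (cases "b2 \<bullet> p' = 0")
      case True
      then show ?thesis using c SQ(4) tq(2) by (metis inner_commute)
    next
      case False
      then have "0 < triple p p' (cross3 b1 b2)" using nonneg s by (simp add: tA)
      then show ?thesis using sup(2) orth(1)[of b1 b2] by (auto simp: b1_def b2_def)
    qed
    ultimately show False using extremal_pair_not_both_rotate[OF C P] mult_neg_pos unfolding a1_def b1_def by metis
  qed
  have rQ: "(a1 \<bullet> q = 0 \<and> a2 \<bullet> p \<noteq> 0) \<or> (b1 \<bullet> q' = 0 \<and> b2 \<bullet> p' \<noteq> 0)"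
  proof (rule ccontr)
    assume c: "\<not> ?thesis"
    have "\<exists>z\<in>dual_cone C. z \<bullet> a2 = 0 \<and> 0 < triple q q' z"
    proof (cases "a1 \<bullet> q = 0")
      case True
      then show ?thesis using c SP(3) tq(3) by (metis inner_commute)
    next
      case False
      then have "0 < triple q q' (cross3 a1 a2)" using nonneg s by (simp add: tA)
      then show ?thesis using sup(1) orth(2)[of a1 a2] by (auto simp: a1_def a2_def)
    qed
    moreover have "\<exists>z\<in>dual_cone C. z \<bullet> b2 = 0 \<and> triple q q' z < 0"
    proof (cases "b1 \<bullet> q' = 0")
      case True
      then show ?thesis using c SP(4) tq(4) by (metis inner_commute)
    next
      case False
      then have "triple q q' (cross3 b1 b2) < 0" using nonneg s by (simp add: tA mult_less_0_iff)
      then show ?thesis using sup(2) orth(2)[of b1 b2] by (auto simp: b1_def b2_def)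
    qed
    ultimately show False using extremal_pair_not_both_rotate[OF C Q] mult_pos_neg unfolding a2_def b2_def by metis
  qed
  have ab: "a1 = p' - k *\<^sub>R p" "a2 = q' - k *\<^sub>R q" "b1 = p - k *\<^sub>R p'" "b2 = q - k *\<^sub>R q'"
    by (simp_all add: a1_def a2_def b1_def b2_def center_vec_def k)
  have eq1: "q' \<bullet> p - k * (q \<bullet> p) = a2 \<bullet> p" "p' \<bullet> q - k * (p \<bullet> q) = a1 \<bullet> q"
    "p \<bullet> q' - k * (p' \<bullet> q') = b1 \<bullet> q'" "q \<bullet> p' - k * (q' \<bullet> p') = b2 \<bullet> p'"
    by (simp_all add: ab inner_diff_left)
  have k0: "k < 0" using neg by (simp add: k_def)
  have "a1 \<bullet> a2 = b1 \<bullet> b2 \<longleftrightarrow> p' \<bullet> q' + k * k * (p \<bullet> q) = p \<bullet> q + k * k * (p' \<bullet> q')"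
    by (simp add: ab inner_diff_left inner_diff_right inner_commute algebra_simps)
  moreover have "p \<bullet> q = p' \<bullet> q'"
    using rP
  proof
    assume 1: "a2 \<bullet> p = 0 \<and> a1 \<bullet> q \<noteq> 0"
    then have "b1 \<bullet> q' = 0" using rQ by blast
    then have "k * (p \<bullet> q) = k * (p' \<bullet> q')" using 1 eq1 by (simp add: inner_commute)
    then show ?thesis using k0 by simp
  next
    assume 1: "b2 \<bullet> p' = 0 \<and> b1 \<bullet> q' \<noteq> 0"
    then have "a1 \<bullet> q = 0" using rQ by blast
    then have "k * (p \<bullet> q) = k * (p' \<bullet> q')" using 1 eq1 by (simp add: inner_commute)
    then show ?thesis using k0 by simp
  qed
  ultimately show ?thesis by (simp add: a1_def a2_def b1_def b2_def)
qed

section \<open>The boundary arcs between neighbouring centers\<close>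

text \<open>An interior point of the polar set from which the angles to \<open>m1\<close>, \<open>m\<close>, \<open>m2\<close> are in the right order is a
  point inside the triangle with these vertices, or, when \<open>m\<close> is on the segment from \<open>m1\<close> to \<open>m2\<close>, inside
  the triangle \<open>m1\<close>, \<open>m2\<close>, \<open>r\<close>.\<close>

lemma support_order_between:
  assumes C: "sph_convex_body C"
    and bd: "m1 \<in> sph_bd (polar C)" "m \<in> sph_bd (polar C)" "m2 \<in> sph_bd (polar C)"
    and bt: "lies_between m1 m m2" and side: "0 < triple m1 m m2 \<or> (\<exists>r\<in>polar C. 0 < triple m1 m2 r)"
  shows "support_order C (hemisphere m1) (hemisphere m) (hemisphere m2)"
proof -
  have pol: "v \<in> polar C" if "v \<in> sph_bd (polar C)" for v
    using that sph_bd_polar_subset[OF C] by blast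
  have S: "v \<in> S2" "v \<in> dual_cone C" if "v \<in> polar C" for v
    using that body_polar_iff[OF C] by blast+
  \<comment> \<open>The curve will be viewed from m1 + m2 + w; independence of these three vectors makes this point interior.\<close>
  obtain w where w: "w \<in> dual_cone C" "0 < triple (m1 + m2 + w) m1 m" "0 < triple (m1 + m2 + w) m m2"
      "triple m1 m2 w \<noteq> 0"
  proof (cases "0 < triple m1 m m2")
    case True
    then show ?thesis
      using that[of m] S pol bd triple_perms[of m1 m m2]
      by (simp add: cross_add_left inner_add_left triple_same)
  next
    case False
    then obtain \<alpha> \<beta> r where "0 < \<alpha>" "0 < \<beta>" "m = \<alpha> *\<^sub>R m1 + \<beta> *\<^sub>R m2"
      "r \<in> polar C" "0 < triple m1 m2 r" using bt side unfolding lies_between_def by blast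
    then show ?thesis
      using that[of r] S triple_perms[of m1 m2 r]
      by (simp add: cross_add_left cross_add_right cross_mult_left cross_mult_right inner_add_left inner_add_right triple_same)
  qed
  define c where "c = m1 + m2 + w"
  have cp: "0 < c \<bullet> p" if "p \<in> C" for p
  proof -
    have n: "0 \<le> m1 \<bullet> p" "0 \<le> m2 \<bullet> p" "0 \<le> w \<bullet> p"
      using S(2)[OF pol[OF bd(1)]] S(2)[OF pol[OF bd(3)]] w(1) dual_coneD that by blast+
    have "c \<bullet> p \<noteq> 0"
    proof
      assume "c \<bullet> p = 0"
      then have "m1 \<bullet> p = 0" "m2 \<bullet> p = 0" "w \<bullet> p = 0" using n by (simp_all add: c_def inner_add_left)
      then have "p = 0" using eq_zero_if_orthogonal_basis[OF w(4)] by blast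
      then show False using body_facts(3)[OF C] that by auto
    qed
    then show ?thesis using n by (simp add: c_def inner_add_left)
  qed
  have "c \<noteq> 0" using w(2) by (auto simp: c_def)
  have "triple (sgn c) u v = triple c u v / norm c" for u v
    by (simp add: sgn_div_norm cross_mult_left divide_inverse)
  then have "0 < triple (sgn c) m1 m" "0 < triple (sgn c) m m2" using w \<open>c \<noteq> 0\<close> by (simp_all add: c_def)
  moreover have "0 < sgn c \<bullet> p" if "p \<in> C" for p using cp[OF that] \<open>c \<noteq> 0\<close> by (simp add: sgn_inner)
  ultimately obtain \<gamma> s t where "positive_boundary_curve \<gamma> (polar C)" "0 < s" "s < t" "t < 1"
    "\<gamma> 0 = m1" "\<gamma> s = m" "\<gamma> t = m2"
    using positive_boundary_curve_through[OF C sgn_S2[OF \<open>c \<noteq> 0\<close>] _ bd] by metis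
  moreover have "supports (hemisphere v) C" if "v \<in> sph_bd (polar C)" for v
    using supports_iff[OF C S(1)[OF pol[OF that]]] that by blast
  ultimately show ?thesis
    unfolding support_order_def using bd S(1)[OF pol] by blast
qed

text \<open>This excludes that the two given lunes are one lune with its hemispheres exchanged. All other
  diametral chords cross \<open>pp'\<close> and so have an endpoint on the required side. If there were no others,
  \<open>p \<times> p'\<close> would vanish at all centers of thinnest lunes and therefore on \<open>R\<close>, which has interior points.\<close>

lemma extremal_pair_beside_exists:
  assumes R: "sph_reduced R" and P: "extremal_pair R p p'" and neg: "p \<bullet> p' < 0"
  shows "\<exists>x y. extremal_pair R x y \<and> 0 < triple p x p'"
proof (rule ccontr)
  assume none: "\<not> ?thesis"
  have C: "sph_convex_body R" using R by (simp add: sph_reduced_def)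
  have only: "(x = p \<and> y = p') \<or> (x = p' \<and> y = p)" if X: "extremal_pair R x y" for x y
  proof -
    have "\<not> 0 < triple p x p'" "\<not> 0 < triple p y p'" using none X extremal_pair_commute[OF X] by blast+
    then have "0 \<le> triple p p' x" "0 \<le> triple p p' y"
      using triple_perms(1)[of p p' x] triple_perms(1)[of p p' y] by simp_all
    then have "\<not> triple p p' x * triple p p' y < 0" by (simp add: not_less)
    then show ?thesis using extremal_pairs_cross[OF C P X neg] by blast
  qed
  have o: "cross3 p p' \<bullet> center_vec p p' = 0" "cross3 p p' \<bullet> center_vec p' p = 0"
    by (simp_all add: center_vec_def inner_diff_right dot_cross_self)
  have "cross3 p p' \<in> dual_cone R" "- cross3 p p' \<in> dual_cone R"
    using centers_generate_reduced[OF R] only o by (metis inner_minus_left neg_0_equal_iff_equal order_refl)+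
  then have "cross3 p p' = 0" using dual_cone_pointed[OF C] by blast
  moreover have "cross3 p p' \<bullet> cross3 p p' \<noteq> 0"
    using cross_norm[of p p'] extremal_pair_S2[OF C P] extremal_pair_square[OF C P] by simp
  ultimately show False by simp
qed

lemma sph_arc_subset_bd:
  assumes C: "sph_convex_body C" and n: "n \<in> dual_cone C" "n \<noteq> 0"
    and ab: "a \<in> C" "b \<in> C" "n \<bullet> a = 0" "n \<bullet> b = 0"
  shows "sph_arc a b \<subseteq> sph_bd C"
proof
  fix z assume z: "z \<in> sph_arc a b"
  then obtain w where w: "w \<in> closed_segment a b" "z = w /\<^sub>R norm w" by (auto simp: sph_arc_def)
  then have "n \<bullet> z = 0" using ab by (auto simp: closed_segment_def inner_add_right)
  moreover have "z \<in> C" using z ab body_facts(1)[OF C] unfolding sph_convex_def by blast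
  ultimately show "z \<in> sph_bd C" using sph_bdI[OF body_facts(2,3)[OF C] _ n] by blast
qed

text \<open>The supporting hemisphere that contains both centers in its boundary is centered at \<open>a \<times> b\<close>, or at \<open>p\<close> if
  the two centers coincide.\<close>

lemma sph_arc_of_centers:
  assumes C: "sph_convex_body C" and P: "extremal_pair C p p'" and Q: "extremal_pair C q q'"
    and sup: "cross3 (center_vec p p') (center_vec q q') \<in> dual_cone C"
  shows "sph_arc (sgn (center_vec p p')) (sgn (center_vec q q')) \<subseteq> sph_bd C"
proof (cases "cross3 (center_vec p p') (center_vec q q') = 0")
  case False
  let ?n = "cross3 (center_vec p p') (center_vec q q')"
  have "?n \<bullet> sgn (center_vec p p') = 0" "?n \<bullet> sgn (center_vec q q') = 0"
    by (simp_all add: sgn_div_norm dot_cross_self)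
  then show ?thesis
    using sph_arc_subset_bd[OF C sup False extremal_pair_facts(3)[OF C P] extremal_pair_facts(3)[OF C Q]] by blast
next
  case True
  let ?a = "sgn (center_vec p p')" let ?b = "sgn (center_vec q q')"
  note aC = extremal_pair_facts(3)[OF C P] note bC = extremal_pair_facts(3)[OF C Q]
  have S: "?a \<in> S2" "?b \<in> S2" using aC bC body_facts(3)[OF C] by blast+
  have "cross3 ?a ?b = 0" using True by (simp add: sgn_div_norm cross_mult_left cross_mult_right)
  then have "1 - (?a \<bullet> ?b)\<^sup>2 = 0" using cross_norm[of ?a ?b] S2_inner_self[OF S(1)] S2_inner_self[OF S(2)] by simp
  then have "?a = ?b \<or> ?a = - ?b" using S2_inner_sq_less[OF S] by fastforce
  moreover have "?a \<noteq> - ?b" using aC bC body_facts(1)[OF C] unfolding sph_convex_def by metis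
  ultimately have eq: "?b = ?a" by metis
  have "p \<bullet> ?a = 0" using center_vec_orth[OF extremal_pair_S2(1)[OF C P], of p'] by (simp add: inner_commute[of p] sgn_inner)
  moreover have "p \<noteq> 0" using extremal_pair_S2(5)[OF C P] by auto
  ultimately show ?thesis
    unfolding eq using sph_arc_subset_bd[OF C extremal_pair_S2(3)[OF C P] _ aC aC] by blast
qed

theorem theorem2p1:
  fixes R M1 M2 M1' M2' :: "(real^3) set" and a1 a2 b1 b2 :: "real^3"
  assumes "sph_reduced R"
    and "thickness R < pi / 2"
    and "supports M1 R" and "supports M2 R"
    and "width R M1 = thickness R" and "width R M2 = thickness R"
    and "\<And>M. support_order R M1 M M2 \<Longrightarrow> width R M > thickness R"
    and "is_star R M1 M1'" and "is_star R M2 M2'"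
    and "a1 = semicircle_center M1 M1'" and "a2 = semicircle_center M2 M2'"
    and "b1 = semicircle_center M1' M1" and "b2 = semicircle_center M2' M2"
  shows "sph_arc a1 a2 \<subseteq> sph_bd R \<and> sph_arc b1 b2 \<subseteq> sph_bd R \<and>
    sph_dist a1 a2 = sph_dist b1 b2"
proof -
  have C: "sph_convex_body R" using assms(1) by (simp add: sph_reduced_def)
  obtain x0 y0 where K: "extremal_pair R x0 y0" using extremal_pair_exists[OF C] .
  have th: "thickness R = arccos (- (x0 \<bullet> y0))" using thickness_eq[OF C K] .
  have neg0: "x0 \<bullet> y0 < 0"
  proof (rule ccontr)
    assume "\<not> x0 \<bullet> y0 < 0"
    moreover have "\<bar>x0 \<bullet> y0\<bar> \<le> 1" using Cauchy_Schwarz_ineq2[of x0 y0] extremal_pair_S2[OF C K] by simp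
    ultimately have "pi / 2 \<le> arccos (- (x0 \<bullet> y0))" using arccos_le_mono[of 0 "- (x0 \<bullet> y0)"] by simp
    then show False using assms(2) th by simp
  qed
  have pair: "\<exists>m m'. M = hemisphere m \<and> M' = hemisphere m' \<and> extremal_pair R m m'"
    if M: "supports M R" "width R M = thickness R" "is_star R M M'" for M M'
  proof -
    obtain m where m: "m \<in> S2" "M = hemisphere m" using M(1) unfolding supports_def by blast
    then have mp: "m \<in> polar R" using M(1) supports_iff[OF C] sph_bd_polar_subset[OF C] by blast
    obtain m' where m': "m' \<in> polar R" "M' = hemisphere m'" "\<forall>z\<in>polar R. m \<bullet> m' \<le> m \<bullet> z"
      using M(3) is_star_iff[OF C mp] m(2) by blast
    have "arccos (- (m \<bullet> m')) = arccos (- (x0 \<bullet> y0))" using width_eq[OF C mp m'(1,3)] M(2) m(2) th by simp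
    then have "m \<bullet> m' \<le> x0 \<bullet> y0"
      using arccos_neg_inner_le[of m m' x0 y0] m(1) m'(1) body_polar_iff[OF C] extremal_pair_S2[OF C K] by auto
    then have "extremal_pair R m m'"
      using extremal_pairD(3)[OF K] mp m'(1) unfolding extremal_pair_def by (meson order_trans)
    then show ?thesis using m m' by blast
  qed
  obtain p p' where P: "M1 = hemisphere p" "M1' = hemisphere p'" "extremal_pair R p p'"
    using pair[OF assms(3,5,8)] by blast
  obtain q q' where Q: "M2 = hemisphere q" "M2' = hemisphere q'" "extremal_pair R q q'"
    using pair[OF assms(4,6,9)] by blast
  note P' = extremal_pair_commute[OF P(3)] and Q' = extremal_pair_commute[OF Q(3)]
  note SP = extremal_pair_S2[OF C P(3)] note SQ = extremal_pair_S2[OF C Q(3)]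
  have neg: "p \<bullet> p' < 0" "q \<bullet> q' < 0"
    using neg0 extremal_pair_same_inner[OF K P(3)] extremal_pair_same_inner[OF K Q(3)] by simp_all
  have centers: "a1 = sgn (center_vec p p')" "a2 = sgn (center_vec q q')" "b1 = sgn (center_vec p' p)" "b2 = sgn (center_vec q' q)"
    using assms(10-13) P Q semicircle_center_eq SP SQ
      extremal_pair_facts(1,2)[OF C P(3)] extremal_pair_facts(1,2)[OF C Q(3)]
      extremal_pair_facts(1,2)[OF C P'] extremal_pair_facts(1,2)[OF C Q'] by simp_all
  have none: "\<not> lies_between p x q"
    if X: "extremal_pair R x y" and side: "0 < triple p x q \<or> (\<exists>r\<in>polar R. 0 < triple p q r)" for x y
  proof
    assume "lies_between p x q"
    then have "support_order R M1 (hemisphere x) M2"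
      unfolding P Q using support_order_between[OF C _ _ _ _ side] extremal_pair_facts(4)[OF C P(3)]
        extremal_pair_facts(4)[OF C Q(3)] extremal_pair_facts(4)[OF C X] by blast
    then have "thickness R < width R (hemisphere x)" by (rule assms(7))
    moreover have "width R (hemisphere x) = thickness R"
      using width_eq[OF C extremal_pairD(1,2)[OF X]] extremal_pairD(1,3)[OF X] thickness_eq[OF C X] by auto
    ultimately show False by simp
  qed
  have none': "triple p x q \<le> 0" if X: "extremal_pair R x y" for x y
    using none[OF X] unfolding lies_between_def by (meson not_less)
  \<comment> \<open>The chords of the two lunes coincide, possibly with exchanged endpoints, or cross.\<close>
  consider (same) "q = p" "q' = p'" | (swapped) "q = p'" "q' = p"
    | (cross) "triple p p' q * triple p p' q' < 0"
    using extremal_pairs_cross[OF C P(3) Q(3) neg(1)] by blast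
  then have "cross3 (center_vec p p') (center_vec q q') \<in> dual_cone R \<and> cross3 (center_vec p' p) (center_vec q' q) \<in> dual_cone R
    \<and> center_vec p p' \<bullet> center_vec q q' = center_vec p' p \<bullet> center_vec q' q"
  proof cases
    case same
    then show ?thesis
      using center_vec_norm[OF SP(1,2)] center_vec_norm[OF SP(2,1)]
      by (simp add: dual_cone_def inner_commute[of p' p] flip: power2_norm_eq_inner)
  next
    case swapped
    obtain x y where "extremal_pair R x y" "0 < triple p x p'"
      using extremal_pair_beside_exists[OF assms(1) P(3) neg(1)] by blast
    then show ?thesis using none' swapped by fastforce
  next
    case cross
    then have "triple q q' p * triple q q' p' < 0"
      using extremal_pairs_cross[OF C Q(3) P(3) neg(2)] by (auto simp: triple_same)
    moreover have "triple p p' q \<le> 0" "triple p q' q \<le> 0" using none' P' Q' by blast+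
    ultimately have or: "0 < triple p q p'" "0 < triple p q q'" "0 < triple p p' q'" "0 < triple q p' q'"
      using cross triple_perms[of p q p'] triple_perms[of p q q'] triple_perms[of q p' q']
      by (auto simp: mult_less_0_iff)
    have nb: "\<forall>x y. extremal_pair R x y \<longrightarrow> \<not> lies_between p x q"
      using none extremal_pairD(2)[OF P(3)] or(1) by blast
    have nb': "\<forall>x y. extremal_pair R x y \<longrightarrow> \<not> lies_between p' x q'"
      using partner_between[OF C neg(1) P(3) Q(3) or] nb extremal_pair_commute by blast
    have "cross3 (center_vec p p') (center_vec q q') \<in> dual_cone R"
      by (rule centers_generate_reduced[OF assms(1)], rule centers_supported[OF C neg(1) P(3) Q(3) or(1,2) nb])
    moreover have prem: "p' \<bullet> p < 0" "0 < triple p' q' p" "0 < triple p' q' q"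
      using neg(1) or triple_perms(3)[of p' q' p] triple_perms(3)[of p' q' q] by (simp_all add: inner_commute[of p' p])
    have "cross3 (center_vec p' p) (center_vec q' q) \<in> dual_cone R"
      by (rule centers_generate_reduced[OF assms(1)], rule centers_supported[OF C prem(1) P' Q' prem(2,3) nb'])
    ultimately show ?thesis using centers_equidistant[OF C neg(1) P(3) Q(3) or] by blast
  qed
  then have sup: "cross3 (center_vec p p') (center_vec q q') \<in> dual_cone R" "cross3 (center_vec p' p) (center_vec q' q) \<in> dual_cone R"
    and eq: "center_vec p p' \<bullet> center_vec q q' = center_vec p' p \<bullet> center_vec q' q" by blast+
  have "norm (center_vec x y) = norm (center_vec y x)" if "x \<in> S2" "y \<in> S2" for x y
    using center_vec_norm[OF that] center_vec_norm[OF that(2,1)] by (metis inner_commute norm_ge_zero power2_eq_imp_eq)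
  then have "sgn (center_vec p p') \<bullet> sgn (center_vec q q') = sgn (center_vec p' p) \<bullet> sgn (center_vec q' q)"
    using eq SP(1,2) SQ(1,2) by (simp add: sgn_div_norm)
  then have "sph_dist a1 a2 = sph_dist b1 b2" by (simp add: centers sph_dist_def)
  then show ?thesis
    using sph_arc_of_centers[OF C P(3) Q(3) sup(1)] sph_arc_of_centers[OF C P' Q' sup(2)] centers by blast
qed

end
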